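(* (Generalized Lanczos equation.) In the flat Friedmann universe with dust and anti-Chaplygin gas described in the context, let $\tau=t_S-t$, where $\tau=0$ is the singular spacelike hypersurface. Let $\widetilde p+\overline p\,\delta(\tau)=p_{ACh}$ with $$p_{ACh}=\sqrt{\frac{A}{6H_S|\tau|}}+\frac43H_S\,\delta(\tau),$$ let $\widetilde\rho=\rho_m+\rho_{ACh}$, and let $\rho_{ACh}$ be generalized to a distribution $$\rho_{ACh}\,a^2=\frac{P(\tau)}{\left[R(\tau)+Q(\tau)\delta(\tau)\right]^{\omega}},$$ where $\omega>0$, $R(\tau)>0$, $Q(\tau)>0$ and $P(\tau)$ is bounded. Then the equation $$\frac{\partial}{\partial t}\left(Ha^2\right)=\left\{-H^2+\frac32\left[\widetilde\rho-\widetilde p-\overline p\,\delta(\tau)\right]\right\}a^2$$ still implies, by applying it to test functions on $(-\varepsilon,\varepsilon)$ and letting $\varepsilon\to0$, the Lanczos equation $$\Delta H|_{t_S}=-\frac32\,\overline p .$$ Hence the second Israel junction condition is satisfied across $\tau=0$, and (the scale factor, and so the induced metric, being continuous) the two space-time regions separated by this hypersurface can be joined.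
   Context: Units $c=1$, $8\pi G/3=1$. The metric is $ds^2=-dt^2+a^2(t)\sum_{\alpha=1}^3(dx^\alpha)^2$, and $H=\dot a/a$ with a dot denoting $d/dt$. The universe contains pressureless dust of energy density $\rho_m=\rho_{m,0}/a^3$ and anti-Chaplygin gas with equation of state $p=A/\rho$; $A,B,\rho_{m,0}>0$ are constants ($B$ fixes $\rho_{ACh}=\sqrt{B/a^6-A}$ away from the singularity), $a_S=(B/A)^{1/6}$ and $H_S=\sqrt{\rho_{m,0}/a_S^3}$. The soft singularity is at $t=t_S$; near it the scale factor has the leading terms $a=a_S-\sqrt{\rho_{m,0}/a_S}\,|\tau|-\sqrt{2Aa_S^2/(3H_S)}\,|\tau|^{3/2}$, so $a$ is continuous, while $H$ is finite and jumps at $t_S$ (expansion turns into contraction). $\Delta H|_{t_S}$ is the jump of $H$ across $t=t_S$. Here $\overline p$ is the coefficient of the Dirac delta $\delta(\tau)$ in the pressure (the distributional pressure on the hypersurface) and $\widetilde p$ is the remaining part of the pressure. The assumed equation is the normal-derivative equation for the extrinsic curvature of the hypersurfaces $t=$ const (a combination of the Raychaudhuri and Friedmann equations); the Lanczos equation relates the jump of the extrinsic curvature to the distributional energy-momentum on the hypersurface. The expression for $\rho_{ACh}a^2$ is understood as a composition of distributions. Regularization: let $\rho(\tau)$ (unrelated to the energy densities) be any infinitely differentiable function with $\rho(\tau)=0$ for $|\tau|\ge1$, $\rho\ge0$, $\rho$ even, $\int_{-1}^1\rho\,d\tau=1$; put $\delta_n(\tau)=n\rho(n\tau)$ and $f_n=f\ast\delta_n$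 for a distribution $f$. The composition $F(f)$ exists and equals the distribution $h$ on $(b,c)$ if $\lim_{n\to\infty}\left[\lim_{m\to\infty}\int_b^cF_n(f_m(\tau))\varphi(\tau)\,d\tau\right]=\langle h,\varphi\rangle$ for all smooth compactly supported $\varphi$ with support in $(b,c)$. For $P[R+Q\delta]^{-\omega}$ this is evaluated as the limit $\lim_{n\to\infty}\lim_{m\to\infty}$ of $\int P_n(\tau)\,\left([R_m+Q_m\delta_m]^{-\omega}\ast\delta_n\right)(\tau)\,\varphi(\tau)\,d\tau$.
   Formalization: It is additionally assumed that R and Q are locally integrable, P is Borel, and R^{-ω} is locally integrable; without the last, e.g. R=|τ|^{1/ω} off τ=0 with P=Q=1, the regularizing limits diverge and ρ_ACh a² is undefined. *)

theory Defs
  imports "HOL-Analysis.Analysis"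
begin

section \<open>Distributions on an open set of the real line\<close>

definition smooth :: "(real \<Rightarrow> real) \<Rightarrow> bool" where
  "smooth f \<longleftrightarrow> (\<forall>k. (deriv ^^ k) f differentiable_on UNIV)"

definition test_function :: "real set \<Rightarrow> (real \<Rightarrow> real) \<Rightarrow> bool" where
  "test_function I \<phi> \<longleftrightarrow>
     smooth \<phi> \<and> compact (closure {x. \<phi> x \<noteq> 0}) \<and> closure {x. \<phi> x \<noteq> 0} \<subseteq> I"

type_synonym functional = "(real \<Rightarrow> real) \<Rightarrow> real"

definition distribution :: "real set \<Rightarrow> functional \<Rightarrow> bool" where
  "distribution I T \<longleftrightarrow>
     (\<forall>\<phi> \<psi> c d. test_function I \<phi> \<longrightarrow> test_function I \<psi> \<longrightarrow>
        T (\<lambda>x. c * \<phi> x + d * \<psi> x) = c * T \<phi> + d * T \<psi>) \<and>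
     (\<forall>K. compact K \<longrightarrow> K \<subseteq> I \<longrightarrow> (\<exists>C N. \<forall>\<phi>. test_function I \<phi> \<longrightarrow> closure {x. \<phi> x \<noteq> 0} \<subseteq> K \<longrightarrow>
        \<bar>T \<phi>\<bar> \<le> C * (\<Sum>k\<le>(N::nat). SUP x. \<bar>(deriv ^^ k) \<phi> x\<bar>)))"

definition dist_eq :: "real set \<Rightarrow> functional \<Rightarrow> functional \<Rightarrow> bool" where
  "dist_eq I T S \<longleftrightarrow> (\<forall>\<phi>. test_function I \<phi> \<longrightarrow> T \<phi> = S \<phi>)"

definition locally_integrable :: "real set \<Rightarrow> (real \<Rightarrow> real) \<Rightarrow> bool" where
  "locally_integrable I f \<longleftrightarrow> (\<forall>K. compact K \<longrightarrow> K \<subseteq> I \<longrightarrow> set_integrable lborel K f)"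

definition regular_dist :: "(real \<Rightarrow> real) \<Rightarrow> functional" where
  "regular_dist f \<phi> = (LINT x|lborel. f x * \<phi> x)"

text \<open>The product \<open>g \<delta>\<close> of a continuous function with the Dirac delta; \<open>\<delta>\<close> has order 0,
  so \<open>g\<close> need not be smooth.\<close>

definition times_delta :: "(real \<Rightarrow> real) \<Rightarrow> functional" where
  "times_delta g \<phi> = g 0 * \<phi> 0"

definition delta :: functional where
  "delta = times_delta (\<lambda>_. 1)"

definition dist_deriv :: "functional \<Rightarrow> functional" where
  "dist_deriv T \<phi> = - T (deriv \<phi>)"


section \<open>Regularization and the composition \<open>P [R + Q \<delta>]\<^sup>-\<^sup>\<omega>\<close>\<close>

definition mollifier :: "(real \<Rightarrow> real) \<Rightarrow> bool" where
  "mollifier \<rho> \<longleftrightarrow> smooth \<rho> \<and> (\<forall>x. \<bar>x\<bar> \<ge> 1 \<longrightarrow> \<rho> x = 0) \<and> (\<forall>x. \<rho> x \<ge> 0) \<and>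
     (\<forall>x. \<rho> (- x) = \<rho> x) \<and> (LINT x:{-1..1}|lborel. \<rho> x) = 1"

definition delta_seq :: "(real \<Rightarrow> real) \<Rightarrow> nat \<Rightarrow> real \<Rightarrow> real" where
  "delta_seq \<rho> n x = real n * \<rho> (real n * x)"

definition convolution :: "(real \<Rightarrow> real) \<Rightarrow> (real \<Rightarrow> real) \<Rightarrow> real \<Rightarrow> real" where
  "convolution f g x = (LINT y|lborel. f y * g (x - y))"

definition regularized :: "(real \<Rightarrow> real) \<Rightarrow> (real \<Rightarrow> real) \<Rightarrow> nat \<Rightarrow> real \<Rightarrow> real" where
  "regularized \<rho> f n = convolution f (delta_seq \<rho> n)"

text \<open>\<open>P [R + Q \<delta>]\<^sup>-\<^sup>\<omega>\<close> exists on \<open>I\<close> and equals \<open>h\<close>: iterated limit, first \<open>m \<rightarrow> \<infinity>\<close>, then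
  \<open>n \<rightarrow> \<infinity>\<close>.\<close>

definition has_composition ::
  "(real \<Rightarrow> real) \<Rightarrow> real set \<Rightarrow> (real \<Rightarrow> real) \<Rightarrow> (real \<Rightarrow> real) \<Rightarrow> (real \<Rightarrow> real) \<Rightarrow> real \<Rightarrow>
   functional \<Rightarrow> bool" where
  "has_composition \<rho> I P R Q \<omega> h \<longleftrightarrow> (\<forall>\<phi>. test_function I \<phi> \<longrightarrow> (\<exists>L.
     (\<forall>\<^sub>F n in sequentially.
        (\<lambda>m. LINT x|lborel. regularized \<rho> P n x *
           regularized \<rho>
             (\<lambda>y. (regularized \<rho> R m y + regularized \<rho> Q m y * delta_seq \<rho> m y) powr (- \<omega>)) n x *
           \<phi> x) \<longlonglongrightarrow> L n) \<and>
     L \<longlonglongrightarrow> h \<phi>))"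


section \<open>The background and its soft singularity\<close>

definition hubble :: "(real \<Rightarrow> real) \<Rightarrow> real \<Rightarrow> real" where
  "hubble a t = deriv a t / a t"

definition jump :: "(real \<Rightarrow> real) \<Rightarrow> real \<Rightarrow> real" where
  "jump f s = Lim (at_right s) f - Lim (at_left s) f"

definition soft_singularity :: "(real \<Rightarrow> real) \<Rightarrow> real \<Rightarrow> real \<Rightarrow> bool" where
  "soft_singularity a t\<^sub>S r \<longleftrightarrow>
     r > 0 \<and>
     (\<forall>t\<in>{t\<^sub>S - r<..<t\<^sub>S + r}. a t > 0) \<and>
     continuous_on {t\<^sub>S - r<..<t\<^sub>S + r} a \<and>
     (\<forall>t\<in>{t\<^sub>S - r<..<t\<^sub>S + r} - {t\<^sub>S}. a differentiable at t) \<and>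
     continuous_on ({t\<^sub>S - r<..<t\<^sub>S + r} - {t\<^sub>S}) (deriv a) \<and>
     (\<exists>H\<^sub>1>0. (hubble a \<longlongrightarrow> H\<^sub>1) (at_left t\<^sub>S)) \<and>
     (\<exists>H\<^sub>2<0. (hubble a \<longlongrightarrow> H\<^sub>2) (at_right t\<^sub>S))"

text \<open>The leading terms of the scale factor at the singularity, with a remainder that is of higher
  order together with its first derivative. They are an instance of \<open>soft_singularity\<close>; the
  converse is not assumed, so that the jump of the Hubble parameter is not prescribed in advance.\<close>

definition leading_terms ::
  "(real \<Rightarrow> real) \<Rightarrow> real \<Rightarrow> real \<Rightarrow> real \<Rightarrow> real \<Rightarrow> bool" where
  "leading_terms a t\<^sub>S A \<rho>\<^sub>m\<^sub>0 a\<^sub>S \<longleftrightarrow>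
     (let H\<^sub>S = sqrt (\<rho>\<^sub>m\<^sub>0 / a\<^sub>S ^ 3) in
      \<exists>r>0. \<exists>e e'.
        (\<forall>t\<in>{t\<^sub>S - r<..<t\<^sub>S + r}. a t = a\<^sub>S - sqrt (\<rho>\<^sub>m\<^sub>0 / a\<^sub>S) * \<bar>t\<^sub>S - t\<bar>
            - sqrt (2 * A * a\<^sub>S\<^sup>2 / (3 * H\<^sub>S)) * \<bar>t\<^sub>S - t\<bar> powr (3/2) + e t) \<and>
        (\<forall>t\<in>{t\<^sub>S - r<..<t\<^sub>S + r} - {t\<^sub>S}. (e has_real_derivative e' t) (at t)) \<and>
        continuous_on ({t\<^sub>S - r<..<t\<^sub>S + r} - {t\<^sub>S}) e' \<and>
        e t\<^sub>S = 0 \<and>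
        ((\<lambda>t. e t / \<bar>t\<^sub>S - t\<bar> powr (3/2)) \<longlongrightarrow> 0) (at t\<^sub>S) \<and>
        ((\<lambda>t. e' t / \<bar>t\<^sub>S - t\<bar> powr (1/2)) \<longlongrightarrow> 0) (at t\<^sub>S))"

lemma soft_singularity_of_leading_terms:
  assumes pos: "A > 0" "\<rho>\<^sub>m\<^sub>0 > 0" "a\<^sub>S > 0" and lead: "leading_terms a t\<^sub>S A \<rho>\<^sub>m\<^sub>0 a\<^sub>S"
  shows "a t\<^sub>S = a\<^sub>S \<and> (\<exists>r. soft_singularity a t\<^sub>S r)"
proof -
  define c where "c = sqrt (\<rho>\<^sub>m\<^sub>0 / a\<^sub>S)"
  define d where "d = sqrt (2 * A * a\<^sub>S\<^sup>2 / (3 * sqrt (\<rho>\<^sub>m\<^sub>0 / a\<^sub>S ^ 3)))"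
  have c: "c > 0" using pos by (simp add: c_def)
  obtain r e e' where r: "r > 0"
    and a: "\<And>t. t \<in> {t\<^sub>S - r<..<t\<^sub>S + r} \<Longrightarrow>
      a t = a\<^sub>S - c * \<bar>t\<^sub>S - t\<bar> - d * \<bar>t\<^sub>S - t\<bar> powr (3/2) + e t"
    and e: "\<And>t. t \<in> {t\<^sub>S - r<..<t\<^sub>S + r} - {t\<^sub>S} \<Longrightarrow> (e has_real_derivative e' t) (at t)"
    and ce': "continuous_on ({t\<^sub>S - r<..<t\<^sub>S + r} - {t\<^sub>S}) e'"
    and e0: "e t\<^sub>S = 0"
    and oe: "((\<lambda>t. e t / \<bar>t\<^sub>S - t\<bar> powr (3/2)) \<longlongrightarrow> 0) (at t\<^sub>S)"
    and oe': "((\<lambda>t. e' t / \<bar>t\<^sub>S - t\<bar> powr (1/2)) \<longlongrightarrow> 0) (at t\<^sub>S)"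
    using lead unfolding leading_terms_def Let_def c_def[symmetric] d_def[symmetric] by blast
  have powr0: "((\<lambda>t. \<bar>t\<^sub>S - t\<bar> powr p) \<longlongrightarrow> 0) (at t\<^sub>S)" if "p > 0" for p
  proof -
    have "((\<lambda>t. \<bar>t\<^sub>S - t\<bar> powr p) \<longlongrightarrow> 0 powr p) (at t\<^sub>S)"
      by (rule tendsto_powr2) (use that in \<open>auto intro!: tendsto_eq_intros always_eventually\<close>)
    then show ?thesis by simp
  qed
  have e_lim: "(e \<longlongrightarrow> 0) (at t\<^sub>S)"
  proof -
    have l: "((\<lambda>t. e t / \<bar>t\<^sub>S - t\<bar> powr (3/2) * \<bar>t\<^sub>S - t\<bar> powr (3/2)) \<longlongrightarrow> 0 * 0) (at t\<^sub>S)"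
      by (intro tendsto_mult oe powr0) simp
    have ev: "\<forall>\<^sub>F t in at t\<^sub>S. e t / \<bar>t\<^sub>S - t\<bar> powr (3/2) * \<bar>t\<^sub>S - t\<bar> powr (3/2) = e t"
      by (auto simp: eventually_at intro!: exI[of _ 1])
    from Lim_transform_eventually[OF l ev] show ?thesis by simp
  qed
  have e'_lim: "(e' \<longlongrightarrow> 0) (at t\<^sub>S)"
  proof -
    have l: "((\<lambda>t. e' t / \<bar>t\<^sub>S - t\<bar> powr (1/2) * \<bar>t\<^sub>S - t\<bar> powr (1/2)) \<longlongrightarrow> 0 * 0) (at t\<^sub>S)"
      by (intro tendsto_mult oe' powr0) simp
    have ev: "\<forall>\<^sub>F t in at t\<^sub>S. e' t / \<bar>t\<^sub>S - t\<bar> powr (1/2) * \<bar>t\<^sub>S - t\<bar> powr (1/2) = e' t"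
      by (auto simp: eventually_at intro!: exI[of _ 1])
    from Lim_transform_eventually[OF l ev] show ?thesis by simp
  qed
  have a0: "a t\<^sub>S = a\<^sub>S" using a[of t\<^sub>S] r e0 by simp
  define a' where "a' t = sgn (t\<^sub>S - t) * (c + 3/2 * d * \<bar>t\<^sub>S - t\<bar> powr (1/2)) + e' t" for t
  have da: "(a has_real_derivative a' t) (at t)" if t: "t \<in> {t\<^sub>S - r<..<t\<^sub>S + r} - {t\<^sub>S}" for t
  proof -
    have "((\<lambda>t. a\<^sub>S - c * \<bar>t\<^sub>S - t\<bar> - d * \<bar>t\<^sub>S - t\<bar> powr (3/2) + e t) has_real_derivative a' t) (at t)"
    proof (cases "t < t\<^sub>S")
      case True
      have "((\<lambda>t. a\<^sub>S - c * (t\<^sub>S - t) - d * (t\<^sub>S - t) powr (3/2) + e t) has_real_derivative a' t) (at t)"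
        by (rule derivative_eq_intros e[OF t] refl | use True in \<open>simp add: a'_def\<close>)+
      then show ?thesis
        by (rule has_field_derivative_transform_within[where d = "t\<^sub>S - t"])
           (use True in \<open>auto simp: dist_real_def\<close>)
    next
      case False
      then have F: "t > t\<^sub>S" using t by auto
      have "((\<lambda>t. a\<^sub>S - c * (t - t\<^sub>S) - d * (t - t\<^sub>S) powr (3/2) + e t) has_real_derivative a' t) (at t)"
        by (rule derivative_eq_intros e[OF t] refl | use F in \<open>simp add: a'_def algebra_simps\<close>)+
      then show ?thesis
        by (rule has_field_derivative_transform_within[where d = "t - t\<^sub>S"])
           (use F in \<open>auto simp: dist_real_def\<close>)
    qed
    then show ?thesis
      by (rule has_field_derivative_transform_within_open[where S = "{t\<^sub>S - r<..<t\<^sub>S + r}"])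
         (use t a in auto)
  qed
  have a_lim: "(a \<longlongrightarrow> a\<^sub>S) (at t\<^sub>S)"
  proof -
    have l: "((\<lambda>t. a\<^sub>S - c * \<bar>t\<^sub>S - t\<bar> - d * \<bar>t\<^sub>S - t\<bar> powr (3/2) + e t) \<longlongrightarrow>
        a\<^sub>S - c * \<bar>t\<^sub>S - t\<^sub>S\<bar> - d * 0 + 0) (at t\<^sub>S)"
      by (intro tendsto_intros powr0 e_lim) simp
    have ev: "\<forall>\<^sub>F t in at t\<^sub>S.
        a\<^sub>S - c * \<bar>t\<^sub>S - t\<bar> - d * \<bar>t\<^sub>S - t\<bar> powr (3/2) + e t = a t"
      using r by (auto simp: eventually_at dist_real_def abs_less_iff a intro!: exI[of _ r])
    from Lim_transform_eventually[OF l ev] show ?thesis by simp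
  qed
  obtain s where s: "s > 0" "s \<le> r" "\<And>t. t \<in> {t\<^sub>S - s<..<t\<^sub>S + s} \<Longrightarrow> a t > 0"
  proof -
    have "\<forall>\<^sub>F t in at t\<^sub>S. a t > 0" by (rule order_tendstoD(1)[OF a_lim]) (use pos in simp)
    then obtain s where "s > 0" "\<And>t. t \<noteq> t\<^sub>S \<Longrightarrow> dist t t\<^sub>S < s \<Longrightarrow> a t > 0"
      by (auto simp: eventually_at)
    then have pa: "a t > 0" if "\<bar>t - t\<^sub>S\<bar> < s" for t
      using that a0 pos by (cases "t = t\<^sub>S") (auto simp: dist_real_def)
    show ?thesis
      by (rule that[of "min s r"]) (use r \<open>s > 0\<close> in \<open>auto intro!: pa simp: abs_less_iff\<close>)
  qed
  have deriv_a: "deriv a t = a' t" if "t \<in> {t\<^sub>S - r<..<t\<^sub>S + r} - {t\<^sub>S}" for t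
    using da[OF that] by (rule DERIV_imp_deriv)
  have "soft_singularity a t\<^sub>S s"
    unfolding soft_singularity_def
  proof (intro conjI ballI)
    show "continuous_on {t\<^sub>S - s<..<t\<^sub>S + s} a"
      unfolding continuous_on_eq_continuous_at[OF open_greaterThanLessThan]
    proof
      fix t assume t: "t \<in> {t\<^sub>S - s<..<t\<^sub>S + s}"
      show "isCont a t"
      proof (cases "t = t\<^sub>S")
        case True then show ?thesis using a_lim a0 by (simp add: isCont_def)
      next
        case False
        then show ?thesis using da[of t] t s by (auto intro: DERIV_isCont)
      qed
    qed
  next
    fix t assume t: "t \<in> {t\<^sub>S - s<..<t\<^sub>S + s} - {t\<^sub>S}"
    show "a differentiable at t" using da[of t] t s by (auto simp: real_differentiable_def)
  next
    have "continuous_on ({t\<^sub>S - r<..<t\<^sub>S + r} - {t\<^sub>S}) a'"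
      unfolding a'_def by (intro continuous_intros ce') auto
    then have "continuous_on ({t\<^sub>S - s<..<t\<^sub>S + s} - {t\<^sub>S}) a'"
      by (rule continuous_on_subset) (use s in auto)
    then show "continuous_on ({t\<^sub>S - s<..<t\<^sub>S + s} - {t\<^sub>S}) (deriv a)"
      by (rule continuous_on_eq) (use s in \<open>auto simp: deriv_a\<close>)
  next
    have l: "((\<lambda>t. (1 * (c + 3/2 * d * \<bar>t\<^sub>S - t\<bar> powr (1/2)) + e' t) / a t) \<longlongrightarrow>
        (1 * (c + 3/2 * d * 0) + 0) / a\<^sub>S) (at_left t\<^sub>S)"
      by (intro tendsto_intros tendsto_within_subset[OF powr0]
          tendsto_within_subset[OF e'_lim] tendsto_within_subset[OF a_lim]) (use pos in auto)
    have ev: "\<forall>\<^sub>F t in at_left t\<^sub>S.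
        (1 * (c + 3/2 * d * \<bar>t\<^sub>S - t\<bar> powr (1/2)) + e' t) / a t = hubble a t"
      unfolding eventually_at_left_field
      by (rule exI[of _ "t\<^sub>S - r"]) (use r in \<open>auto simp: hubble_def deriv_a a'_def\<close>)
    from Lim_transform_eventually[OF l ev] have "(hubble a \<longlongrightarrow> c / a\<^sub>S) (at_left t\<^sub>S)" by simp
    then show "\<exists>H\<^sub>1>0. (hubble a \<longlongrightarrow> H\<^sub>1) (at_left t\<^sub>S)" using c pos by (intro exI[of _ "c / a\<^sub>S"]) simp
  next
    have l: "((\<lambda>t. ((-1) * (c + 3/2 * d * \<bar>t\<^sub>S - t\<bar> powr (1/2)) + e' t) / a t) \<longlongrightarrow>
        ((-1) * (c + 3/2 * d * 0) + 0) / a\<^sub>S) (at_right t\<^sub>S)"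
      by (intro tendsto_intros tendsto_within_subset[OF powr0]
          tendsto_within_subset[OF e'_lim] tendsto_within_subset[OF a_lim]) (use pos in auto)
    have ev: "\<forall>\<^sub>F t in at_right t\<^sub>S.
        ((-1) * (c + 3/2 * d * \<bar>t\<^sub>S - t\<bar> powr (1/2)) + e' t) / a t = hubble a t"
      unfolding eventually_at_right_field
      by (rule exI[of _ "t\<^sub>S + r"]) (use r in \<open>auto simp: hubble_def deriv_a a'_def\<close>)
    from Lim_transform_eventually[OF l ev] have "(hubble a \<longlongrightarrow> - c / a\<^sub>S) (at_right t\<^sub>S)" by simp
    then show "\<exists>H\<^sub>2<0. (hubble a \<longlongrightarrow> H\<^sub>2) (at_right t\<^sub>S)" using c pos by (intro exI[of _ "- c / a\<^sub>S"]) simp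
  qed (use s in auto)
  then show ?thesis using a0 by blast
qed


section \<open>Junction conditions across a spacelike hypersurface\<close>

text \<open>The space-time metric is \<open>- dt\<^sup>2 + \<gamma>\<^sub>\<alpha>\<^sub>\<beta>(t) dx\<^sup>\<alpha> dx\<^sup>\<beta>\<close>, so that \<open>\<partial>\<^sub>t\<close> is the unit normal of the
  hypersurfaces of constant \<open>t\<close> and their extrinsic curvature is \<open>K\<^sub>\<alpha>\<^sub>\<beta> = \<partial>\<^sub>t \<gamma>\<^sub>\<alpha>\<^sub>\<beta> / 2\<close>.\<close>

definition flat_metric :: "(real \<Rightarrow> real) \<Rightarrow> real \<Rightarrow> real ^ 3 ^ 3" where
  "flat_metric a t = (a t)\<^sup>2 *\<^sub>R mat 1"

definition extrinsic_curvature :: "(real \<Rightarrow> real ^ 3 ^ 3) \<Rightarrow> real \<Rightarrow> real ^ 3 ^ 3" where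
  "extrinsic_curvature \<gamma> t = (\<chi> \<alpha> \<beta>. deriv (\<lambda>s. \<gamma> s $ \<alpha> $ \<beta>) t / 2)"

definition first_junction_condition :: "(real \<Rightarrow> real ^ 3 ^ 3) \<Rightarrow> real \<Rightarrow> bool" where
  "first_junction_condition \<gamma> s \<longleftrightarrow> isCont \<gamma> s"

text \<open>The Lanczos equation \<open>[K\<^sub>\<alpha>\<^sub>\<beta>] - [K] \<gamma>\<^sub>\<alpha>\<^sub>\<beta> = 8 \<pi> G S\<^sub>\<alpha>\<^sub>\<beta>\<close> for a spacelike hypersurface (the timelike
  case has the opposite sign), with \<open>8 \<pi> G = 3\<close>; \<open>S\<close> is the energy-momentum concentrated on the
  hypersurface.\<close>

definition second_junction_condition ::
  "(real \<Rightarrow> real ^ 3 ^ 3) \<Rightarrow> real \<Rightarrow> real ^ 3 ^ 3 \<Rightarrow> bool" where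
  "second_junction_condition \<gamma> s S \<longleftrightarrow> (\<exists>K\<^sub>1 K\<^sub>2.
     (extrinsic_curvature \<gamma> \<longlongrightarrow> K\<^sub>1) (at_left s) \<and>
     (extrinsic_curvature \<gamma> \<longlongrightarrow> K\<^sub>2) (at_right s) \<and>
     (K\<^sub>2 - K\<^sub>1) - trace (matrix_inv (\<gamma> s) ** (K\<^sub>2 - K\<^sub>1)) *\<^sub>R \<gamma> s = 3 *\<^sub>R S)"

definition joinable :: "(real \<Rightarrow> real ^ 3 ^ 3) \<Rightarrow> real \<Rightarrow> real ^ 3 ^ 3 \<Rightarrow> bool" where
  "joinable \<gamma> s S \<longleftrightarrow> first_junction_condition \<gamma> s \<and> second_junction_condition \<gamma> s S"

end

(* The composed gas term is dominated by (sup |P|) times a local integral of R powr (- omega):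
   dropping the nonnegative part Q delta only increases the power, and Jensen's inequality moves
   the convex power inside the mollification. Hence, tested against uniformly bounded bumps that
   shrink to the hypersurface, it vanishes in the limit together with all the locally integrable
   terms. What remains is the jump of H a^2 on the left and the delta part of the pressure on the
   right. *)

theory Submission
  imports Defs
begin

text \<open>A distribution is in general controlled only by derivatives of the test function, and
  those of \<open>\<psi> (x / e)\<close> grow like powers of \<open>1 / e\<close>. The gas term
  therefore needs a bound by the sup norm and the support of the test function alone. Such a bound
  is available before any limit is taken: for a test function supported in \<open>{- s..s}\<close>,
  one constant serves for all \<open>m\<close> and \<open>n\<close> beyond \<open>2 / s\<close>, so
  it passes through both limits.

  The inner function is a mollified power of mollified functions, and its integrability is awkward
  to establish. The estimates therefore run through nonnegative integrals, where Tonelli applies and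
  where a nonintegrable function, having Bochner integral 0, causes no harm.

  On the left the growing factor \<open>1 / e\<close> does occur, but it is cancelled by the scaling
  of Lebesgue measure, so that only the one-sided limits of \<open>H a^2\<close> survive.\<close>

section \<open>Smooth functions under affine substitution, and rescaled test functions\<close>

lemma smooth_has_deriv_funpow:
  assumes "smooth f"
  shows "((deriv ^^ k) f has_real_derivative (deriv ^^ Suc k) f x) (at x)"
  using assms unfolding smooth_def differentiable_on_def
  by (auto simp: DERIV_deriv_iff_real_differentiable)

lemma smooth_affine_has_deriv_funpow:
  assumes "smooth f"
  shows "((\<lambda>x. c ^ k * (deriv ^^ k) f (c * x + d)) has_real_derivative
      c ^ Suc k * (deriv ^^ Suc k) f (c * x + d)) (at x)"
proof -
  have "((\<lambda>x. c * x + d) has_real_derivative c) (at x)"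
    by (auto intro!: derivative_eq_intros)
  note DERIV_cmult[OF DERIV_chain'[OF this smooth_has_deriv_funpow[OF assms, of k]], of "c ^ k"]
  then show ?thesis by (simp add: ac_simps)
qed

lemma deriv_funpow_affine:
  assumes "smooth f"
  shows "(deriv ^^ k) (\<lambda>x. f (c * x + d)) = (\<lambda>x. c ^ k * (deriv ^^ k) f (c * x + d))"
proof (induction k)
  case (Suc k)
  show ?case
  proof
    show "(deriv ^^ Suc k) (\<lambda>x. f (c * x + d)) x = c ^ Suc k * (deriv ^^ Suc k) f (c * x + d)" for x
      using DERIV_imp_deriv[OF smooth_affine_has_deriv_funpow[OF assms, of c k d x]]
      by (simp add: Suc)
  qed
qed simp

lemma smooth_affine:
  assumes "smooth f"
  shows "smooth (\<lambda>x. f (c * x + d))"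
  unfolding smooth_def deriv_funpow_affine[OF assms] differentiable_on_def
  using smooth_affine_has_deriv_funpow[OF assms] real_differentiable_def by blast

lemma smooth_has_deriv:
  assumes "smooth f" shows "(f has_real_derivative deriv f x) (at x)"
  using smooth_has_deriv_funpow[OF assms, of 0 x] by simp

lemma smooth_continuous: "smooth f \<Longrightarrow> continuous_on S f"
  by (meson DERIV_isCont continuous_at_imp_continuous_on smooth_has_deriv)

lemma smooth_deriv: "smooth f \<Longrightarrow> smooth (deriv f)"
  unfolding smooth_def by (metis comp_apply funpow_Suc_right)

lemma continuous_compact_support_bounded:
  fixes f :: "real \<Rightarrow> real"
  assumes "continuous_on UNIV f" "\<And>x. \<bar>x\<bar> > c \<Longrightarrow> f x = 0"
  obtains K where "K > 0" "\<And>x. \<bar>f x\<bar> \<le> K"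
proof -
  have "bounded (f ` {-c..c})"
    by (intro compact_imp_bounded compact_continuous_image) (use assms in \<open>auto intro: continuous_on_subset\<close>)
  then obtain K where K: "K > 0" "\<And>x. x \<in> {-c..c} \<Longrightarrow> \<bar>f x\<bar> \<le> K"
    by (auto simp: bounded_pos)
  have "\<bar>f x\<bar> \<le> K" for x
    using K assms(2)[of x] by (cases "x \<in> {-c..c}") auto
  with K(1) that show ?thesis by blast
qed

text \<open>Supplies the shrinking bumps: for every \<open>e\<close> the sup norm and the value at 0
  are those of \<open>\<psi>\<close>, while the support is pressed into
  \<open>{-e..e}\<close>.\<close>

lemma test_function_rescale:
  assumes "smooth \<psi>" "\<And>x. \<bar>x\<bar> \<ge> 1 \<Longrightarrow> \<psi> x = 0" "e > 0" "{-e..e} \<subseteq> I"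
  shows "test_function I (\<lambda>x. \<psi> (x / e))"
proof -
  have "\<bar>x\<bar> \<le> e" if "\<psi> (x / e) \<noteq> 0" for x
    using assms(2)[of "x / e"] that assms(3) by (force simp: field_simps abs_if split: if_splits)
  then have "{x. \<psi> (x / e) \<noteq> 0} \<subseteq> {-e..e}" by force
  then have sub: "closure {x. \<psi> (x / e) \<noteq> 0} \<subseteq> {-e..e}" by (simp add: closure_minimal)
  then have "compact (closure {x. \<psi> (x / e) \<noteq> 0})"
    using bounded_subset[OF bounded_closed_interval] by (simp add: compact_eq_bounded_closed)
  moreover have "smooth (\<lambda>x. \<psi> (x / e))"
    using smooth_affine[OF assms(1), of "1 / e" 0] by simp
  ultimately show ?thesis using sub assms(4) by (auto simp: test_function_def)
qed

section \<open>Mollifiers: support, mass and integrability\<close>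

text \<open>True for arbitrary \<open>f\<close>, because the Bochner integral of a nonintegrable
  function is 0 by convention. This lets regularizations be estimated without first showing them
  integrable.\<close>

lemma abs_integral_le_nn_integral:
  fixes f :: "'a \<Rightarrow> real"
  shows "ennreal \<bar>integral\<^sup>L M f\<bar> \<le> (\<integral>\<^sup>+x. ennreal \<bar>f x\<bar> \<partial>M)"
  using integral_norm_bound_ennreal[of M f]
  by (cases "integrable M f") (auto simp: not_integrable_integral_eq)

lemma mollifier_measurable: "mollifier \<rho> \<Longrightarrow> \<rho> \<in> borel_measurable borel"
  by (auto simp: mollifier_def intro: borel_measurable_continuous_onI smooth_continuous)

lemma delta_seq_measurable: "mollifier \<rho> \<Longrightarrow> delta_seq \<rho> n \<in> borel_measurable borel"
  using mollifier_measurable[of \<rho>] by (simp add: delta_seq_def[abs_def])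

lemma delta_seq_nonneg: "mollifier \<rho> \<Longrightarrow> delta_seq \<rho> n x \<ge> 0"
  by (simp add: mollifier_def delta_seq_def)

lemma delta_seq_support:
  assumes "mollifier \<rho>" "delta_seq \<rho> n x \<noteq> 0"
  shows "\<bar>x\<bar> < 1 / n"
proof -
  \<comment> \<open>For \<open>n = 0\<close> the sequence is identically 0, so a nonzero value
    excludes that index.\<close>
  from assms have "n > 0" "\<not> 1 \<le> \<bar>n * x\<bar>"
    unfolding mollifier_def delta_seq_def by (auto intro: Nat.gr0I)
  then show ?thesis by (simp add: field_simps abs_mult)
qed

lemma nn_integral_mollifier:
  assumes "mollifier \<rho>"
  shows "(\<integral>\<^sup>+x. ennreal (\<rho> x) \<partial>lborel) = 1"
proof -
  have eq: "(\<lambda>x. indicator {-1..1} x *\<^sub>R \<rho> x) = \<rho>"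
    using assms by (force simp: mollifier_def fun_eq_iff indicator_def)
  then have "integral\<^sup>L lborel \<rho> = 1"
    using assms by (simp add: mollifier_def set_lebesgue_integral_def)
  \<comment> \<open>Without integrability the Bochner integral would be 0 rather than 1.\<close>
  moreover have "integrable lborel \<rho>"
    using calculation not_integrable_integral_eq by fastforce
  ultimately show ?thesis
    using assms by (subst nn_integral_eq_integral) (auto simp: mollifier_def)
qed

lemma nn_integral_delta_seq:
  assumes "mollifier \<rho>" "n > 0"
  shows "(\<integral>\<^sup>+y. ennreal (delta_seq \<rho> n (x - y)) \<partial>lborel) = 1"
    and "(\<integral>\<^sup>+x. ennreal (delta_seq \<rho> n (x - y)) \<partial>lborel) = 1"
proof -
  have m: "(\<lambda>x. ennreal (\<rho> x)) \<in> borel_measurable borel" "\<rho> \<in> borel_measurable borel"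
    using mollifier_measurable[OF assms(1)] by auto
  have nn: "\<rho> x \<ge> 0" for x using assms(1) by (simp add: mollifier_def)
  show "(\<integral>\<^sup>+y. ennreal (delta_seq \<rho> n (x - y)) \<partial>lborel) = 1"
    using nn_integral_real_affine[OF m(1), of "- real n" "real n * x"] assms m nn
    by (simp add: nn_integral_mollifier delta_seq_def ennreal_mult nn_integral_cmult right_diff_distrib)
  show "(\<integral>\<^sup>+x. ennreal (delta_seq \<rho> n (x - y)) \<partial>lborel) = 1"
    using nn_integral_real_affine[OF m(1), of "real n" "- real n * y"] assms m nn
    by (simp add: nn_integral_mollifier delta_seq_def ennreal_mult nn_integral_cmult right_diff_distrib)
qed

text \<open>Tonelli: integrating over \<open>x\<close> first meets a density of mass one. It will be
  used for both layers of regularization.\<close>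

lemma nn_integral_convolution_delta_seq:
  assumes "mollifier \<rho>" "n > 0" and [measurable]: "u \<in> borel_measurable borel"
  shows "(\<integral>\<^sup>+x. (\<integral>\<^sup>+y. u y * ennreal (delta_seq \<rho> n (x - y)) \<partial>lborel) \<partial>lborel)
    = (\<integral>\<^sup>+y. u y \<partial>lborel)"
proof -
  note [measurable] = delta_seq_measurable[OF assms(1)]
  have "(\<integral>\<^sup>+x. (\<integral>\<^sup>+y. u y * ennreal (delta_seq \<rho> n (x - y)) \<partial>lborel) \<partial>lborel)
    = (\<integral>\<^sup>+y. (\<integral>\<^sup>+x. u y * ennreal (delta_seq \<rho> n (x - y)) \<partial>lborel) \<partial>lborel)"
    by (rule lborel_pair.Fubini') measurable
  also have "\<dots> = (\<integral>\<^sup>+y. u y \<partial>lborel)"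
    by (simp add: nn_integral_cmult nn_integral_delta_seq[OF assms(1,2)])
  finally show ?thesis .
qed

text \<open>The truncations to \<open>{- n..n}\<close> are measurable, and at each point they
  eventually agree with \<open>f\<close>.\<close>

lemma locally_integrable_measurable:
  assumes "locally_integrable UNIV f"
  shows "f \<in> borel_measurable borel"
proof (rule borel_measurable_LIMSEQ_metric)
  show "(\<lambda>x. indicator {- real n..real n} x *\<^sub>R f x) \<in> borel_measurable borel" for n
  proof -
    have "set_integrable lborel {- real n..real n} f"
      using assms by (simp add: locally_integrable_def)
    from borel_measurable_integrable[OF this[unfolded set_integrable_def]] show ?thesis by simp
  qed
  fix x
  obtain N where "\<bar>x\<bar> \<le> real N" using real_arch_simple by blast
  then have "\<forall>\<^sub>F n in sequentially. f x = indicator {- real n..real n} x *\<^sub>R f x"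
    by (intro eventually_sequentiallyI[of N]) (auto simp: indicator_def)
  then show "(\<lambda>n. indicator {- real n..real n} x *\<^sub>R f x) \<longlonglongrightarrow> f x"
    by (rule Lim_transform_eventually[rotated]) simp
qed

text \<open>The kernel is bounded by \<open>m * K\<close> and, since \<open>1 / m \<le> 1\<close>,
  lives in the window \<open>{y - 1..y + 1}\<close> for every \<open>m \<ge> 1\<close>; local
  integrability on that window suffices.\<close>

lemma integrable_times_delta_seq:
  assumes "mollifier \<rho>" "locally_integrable UNIV f"
  shows "integrable lborel (\<lambda>z. f z * delta_seq \<rho> m (y - z))"
proof -
  note [measurable] = delta_seq_measurable[OF assms(1)] locally_integrable_measurable[OF assms(2)]
  have sm: "smooth \<rho>" and z: "\<And>x. \<bar>x\<bar> > 1 \<Longrightarrow> \<rho> x = 0" using assms(1) by (auto simp: mollifier_def)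
  obtain K where K: "K > 0" "\<And>x. \<bar>\<rho> x\<bar> \<le> K"
    by (rule continuous_compact_support_bounded[OF smooth_continuous[OF sm] z]) auto
  let ?J = "{y - 1..y + 1}"
  have "set_integrable lborel ?J f" using assms(2) by (simp add: locally_integrable_def)
  then have int: "integrable lborel (\<lambda>z. real m * K * (indicator ?J z *\<^sub>R f z))"
    by (simp add: set_integrable_def)
  show ?thesis
  proof (rule Bochner_Integration.integrable_bound[OF int])
    show "AE z in lborel. norm (f z * delta_seq \<rho> m (y - z)) \<le>
        norm (real m * K * (indicator ?J z *\<^sub>R f z))"
    proof (intro AE_I2)
      fix z
      show "norm (f z * delta_seq \<rho> m (y - z)) \<le> norm (real m * K * (indicator ?J z *\<^sub>R f z))"
      proof (cases "delta_seq \<rho> m (y - z) = 0")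
        case False
        have "m > 0" using False by (auto simp: delta_seq_def intro: Nat.gr0I)
        then have "1 / real m \<le> 1" by simp
        then have "z \<in> ?J" using delta_seq_support[OF assms(1) False] by auto
        moreover have "\<bar>delta_seq \<rho> m (y - z)\<bar> \<le> real m * K"
          using K(2)[of "real m * (y - z)"] by (simp add: delta_seq_def abs_mult mult_left_mono)
        then have "\<bar>delta_seq \<rho> m (y - z)\<bar> * \<bar>f z\<bar> \<le> real m * K * \<bar>f z\<bar>"
          by (rule mult_right_mono) simp
        ultimately show ?thesis using K(1)
          by (simp add: abs_mult mult.commute)
      qed simp
    qed
  qed simp
qed

section \<open>Domination of the composed gas term\<close>

text \<open>The supporting line at \<open>c\<close> of a convex function. With
  \<open>u = x / c\<close> it reduces to \<open>u powr (-\<omega>) = exp (-\<omega> ln u) \<ge> 1 -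
  \<omega> ln u \<ge> 1 - \<omega> (u - 1)\<close>.\<close>

lemma powr_minus_tangent:
  fixes x c \<omega> :: real
  assumes "x > 0" "c > 0" "\<omega> > 0"
  shows "c powr (-\<omega>) - \<omega> * c powr (-\<omega>) / c * (x - c) \<le> x powr (-\<omega>)"
proof -
  define u where "u = x / c"
  have u: "u > 0" "x = c * u" using assms by (auto simp: u_def)
  have "\<omega> * ln u \<le> \<omega> * (u - 1)"
    using ln_le_minus_one[OF u(1)] assms by (intro mult_left_mono) auto
  then have "1 - \<omega> * (u - 1) \<le> 1 + (- \<omega> * ln u)" by simp
  also have "\<dots> \<le> u powr (-\<omega>)"
    using exp_ge_add_one_self[of "- \<omega> * ln u"] u by (simp add: powr_def)
  finally have "c powr (-\<omega>) * (1 - \<omega> * (u - 1)) \<le> c powr (-\<omega>) * u powr (-\<omega>)"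
    by (rule mult_left_mono) simp
  also have "\<dots> = x powr (-\<omega>)" unfolding u(2) by (rule powr_mult[symmetric])
  also have "c powr (-\<omega>) * (1 - \<omega> * (u - 1)) =
      c powr (-\<omega>) - \<omega> * c powr (-\<omega>) / c * (x - c)"
    using assms unfolding u(2) by (simp add: right_diff_distrib)
  finally show ?thesis .
qed

text \<open>Jensen's inequality for the convex function \<open>x powr (- \<omega>)\<close>, with the supporting line taken
  at \<open>c\<close> itself; for \<open>c = 0\<close> it relies on \<open>0 powr (- \<omega>) = 0\<close>.\<close>

lemma powr_minus_le_regularized:
  assumes "mollifier \<rho>" "m > 0" "\<omega> > 0"
    and R: "locally_integrable UNIV R" "\<And>x. x \<noteq> 0 \<Longrightarrow> R x > 0"
    and W: "locally_integrable UNIV (\<lambda>x. R x powr (- \<omega>))"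
    and c: "regularized \<rho> R m y \<le> c" "c \<ge> 0"
  shows "c powr (- \<omega>) \<le> regularized \<rho> (\<lambda>x. R x powr (- \<omega>)) m y"
proof (cases "c = 0")
  case True
  have "0 \<le> regularized \<rho> (\<lambda>x. R x powr (- \<omega>)) m y"
    unfolding regularized_def convolution_def
    by (intro Bochner_Integration.integral_nonneg mult_nonneg_nonneg delta_seq_nonneg assms) auto
  then show ?thesis using True by simp
next
  case False
  then have "c > 0" using c by simp
  let ?d = "\<lambda>z. delta_seq \<rho> m (y - z)"
  define k where "k = \<omega> * c powr (-\<omega>) / c"
  note [measurable] = delta_seq_measurable[OF assms(1)]
  have d: "has_bochner_integral lborel ?d 1"
    using nn_integral_delta_seq(1)[OF assms(1,2), of y]
    by (intro has_bochner_integral_nn_integral) (auto simp: delta_seq_nonneg[OF assms(1)])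
  note iR = integrable_times_delta_seq[OF assms(1) R(1), of m y]
  \<comment> \<open>The supporting line at \<open>c\<close>, averaged against the kernel: its mean
    depends on \<open>R\<close> only through \<open>regularized \<rho> R m y\<close>.\<close>
  have "has_bochner_integral lborel (\<lambda>z. (c powr (-\<omega>) + k * c) * ?d z - k * (R z * ?d z))
    ((c powr (-\<omega>) + k * c) * 1 - k * regularized \<rho> R m y)"
    unfolding regularized_def convolution_def
    by (intro has_bochner_integral_diff has_bochner_integral_mult_right d
        has_bochner_integral_integrable iR)
  then have "(c powr (-\<omega>) + k * c) * 1 - k * regularized \<rho> R m y =
      (LINT z|lborel. (c powr (-\<omega>) + k * c) * ?d z - k * (R z * ?d z))"
    and int: "integrable lborel (\<lambda>z. (c powr (-\<omega>) + k * c) * ?d z - k * (R z * ?d z))"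
    by (auto simp: has_bochner_integral_iff)
  note this(1)
  also have "(LINT z|lborel. (c powr (-\<omega>) + k * c) * ?d z - k * (R z * ?d z))
    \<le> (LINT z|lborel. R z powr (-\<omega>) * ?d z)"
  proof (rule integral_mono_AE[OF int integrable_times_delta_seq[OF assms(1) W]])
    \<comment> \<open>\<open>R\<close> is known to be positive only off 0, so the supporting line is
      compared with the power almost everywhere.\<close>
    have "AE z in lborel. z \<noteq> (0::real)" by (rule AE_lborel_singleton)
    then show "AE z in lborel. (c powr (-\<omega>) + k * c) * ?d z - k * (R z * ?d z)
      \<le> R z powr (-\<omega>) * ?d z"
    proof eventually_elim
      case (elim z)
      from mult_right_mono[OF powr_minus_tangent[OF R(2)[OF elim] \<open>c > 0\<close> \<open>\<omega> > 0\<close>, folded k_def]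
          delta_seq_nonneg[OF assms(1), of m "y - z"]]
      show ?case by (simp add: algebra_simps)
    qed
  qed
  finally have "(c powr (-\<omega>) + k * c) - k * regularized \<rho> R m y \<le>
      regularized \<rho> (\<lambda>x. R x powr (- \<omega>)) m y"
    by (simp add: regularized_def convolution_def)
  \<comment> \<open>The line falls with slope \<open>- k\<close>, and the mean of \<open>R\<close>
    is at most \<open>c\<close>; hence the mean of the line is at least its value
    \<open>c powr (-\<omega>)\<close> at \<open>c\<close>.\<close>
  moreover have "k * regularized \<rho> R m y \<le> k * c"
    using c \<open>\<omega> > 0\<close> by (intro mult_left_mono) (auto simp: k_def)
  ultimately show ?thesis by linarith
qed

lemma ennreal_regularized_le:
  assumes "mollifier \<rho>"
  shows "ennreal \<bar>regularized \<rho> f n x\<bar>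
    \<le> (\<integral>\<^sup>+y. ennreal \<bar>f y\<bar> * ennreal (delta_seq \<rho> n (x - y)) \<partial>lborel)"
proof -
  have "ennreal \<bar>f y * delta_seq \<rho> n (x - y)\<bar> = ennreal \<bar>f y\<bar> * ennreal (delta_seq \<rho> n (x - y))" for y
    using delta_seq_nonneg[OF assms, of n "x - y"] by (simp add: abs_mult ennreal_mult)
  then show ?thesis
    unfolding regularized_def convolution_def
    using abs_integral_le_nn_integral[of lborel "\<lambda>y. f y * delta_seq \<rho> n (x - y)"] by simp
qed

lemma regularized_bounded:
  assumes "mollifier \<rho>" "n > 0" "M \<ge> 0" "\<And>x. \<bar>f x\<bar> \<le> M"
  shows "\<bar>regularized \<rho> f n x\<bar> \<le> M"
proof -
  note [measurable] = delta_seq_measurable[OF assms(1)]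
  note ennreal_regularized_le[OF assms(1), of f n x]
  also have "(\<integral>\<^sup>+y. ennreal \<bar>f y\<bar> * ennreal (delta_seq \<rho> n (x - y)) \<partial>lborel)
      \<le> (\<integral>\<^sup>+y. ennreal M * ennreal (delta_seq \<rho> n (x - y)) \<partial>lborel)"
    by (intro nn_integral_mono mult_right_mono ennreal_leI assms) simp
  also have "\<dots> = ennreal M"
    by (simp add: nn_integral_cmult nn_integral_delta_seq(1)[OF assms(1,2)])
  finally show ?thesis using assms(3) by simp
qed

text \<open>The bound involves neither \<open>m\<close> nor \<open>n\<close>. Each mollification
  conserves mass and moves it by less than \<open>s / 2\<close>, so only the mass of
  \<open>W\<close> within \<open>2 * s\<close> of 0 can reach the support of
  \<open>\<phi>\<close>.\<close>

lemma abs_regularized_integral_le: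
  fixes R Q :: "real \<Rightarrow> real" and \<omega> :: real
  defines "W \<equiv> \<lambda>x. R x powr (- \<omega>)"
  assumes \<rho>: "mollifier \<rho>" and "\<omega> > 0" and P: "M \<ge> 0" "\<And>x. \<bar>P x\<bar> \<le> M"
    and R: "locally_integrable UNIV R" "\<And>x. x \<noteq> 0 \<Longrightarrow> R x > 0"
    and Q: "\<And>x. x \<noteq> 0 \<Longrightarrow> Q x > 0"
    and W: "locally_integrable UNIV W"
    and \<phi>: "K \<ge> 0" "\<And>x. \<bar>\<phi> x\<bar> \<le> K" "\<And>x. \<bar>x\<bar> > s \<Longrightarrow> \<phi> x = 0"
    and mn: "2 / s < real m" "2 / s < real n" "s > 0"
  shows "\<bar>LINT x|lborel. regularized \<rho> P n x *
      regularized \<rho> (\<lambda>y. (regularized \<rho> R m y + regularized \<rho> Q m y * delta_seq \<rho> m y) powr (- \<omega>)) n x *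
      \<phi> x\<bar> \<le> M * K * (LINT x:{- (2 * s)..2 * s}|lborel. W x)"
proof -
  define g where "g y = (regularized \<rho> R m y + regularized \<rho> Q m y * delta_seq \<rho> m y) powr (- \<omega>)" for y
  let ?d = "delta_seq \<rho>"
  have "2 / s > 0" using mn by simp
  then have pos: "m > 0" "n > 0" using mn(1,2) by linarith+
  \<comment> \<open>The threshold \<open>2 / s\<close> is chosen so that from
    \<open>\<bar>x\<bar> \<le> s\<close> the two steps from \<open>x\<close> to \<open>y\<close> and
    from \<open>y\<close> to \<open>z\<close> together cover less than \<open>s\<close>.\<close>
  have small: "1 / real m < s / 2" "1 / real n < s / 2" using mn pos by (simp_all add: field_simps)
  note [measurable] = delta_seq_measurable[OF \<rho>] locally_integrable_measurable[OF W]
  have Wnn: "W x \<ge> 0" for x by (simp add: W_def)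
  have nn: "0 \<le> regularized \<rho> f m y" if "\<And>x. x \<noteq> 0 \<Longrightarrow> f x > 0" for f y
    unfolding regularized_def convolution_def
  proof (rule integral_nonneg_AE)
    have "AE z in lborel. z \<noteq> (0::real)" by (rule AE_lborel_singleton)
    then show "AE z in lborel. 0 \<le> f z * ?d m (y - z)"
      by eventually_elim (simp add: that less_imp_le delta_seq_nonneg[OF \<rho>])
  qed
  have g: "ennreal \<bar>g y\<bar> \<le> (\<integral>\<^sup>+z. ennreal (W z) * ennreal (?d m (y - z)) \<partial>lborel)" for y
  proof -
    \<comment> \<open>Here \<open>c\<close> is the full base \<open>R_m + Q_m delta_m\<close>. As
      \<open>Q_m delta_m \<ge> 0\<close>, it lies above \<open>regularized \<rho> R m y\<close>, as
      the Jensen estimate requires.\<close>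
    have "g y \<le> regularized \<rho> W m y"
      unfolding g_def W_def
      by (rule powr_minus_le_regularized[OF \<rho> pos(1) \<open>\<omega> > 0\<close> R W[unfolded W_def]])
        (simp_all add: nn R Q delta_seq_nonneg[OF \<rho>])
    then have "\<bar>g y\<bar> \<le> \<bar>regularized \<rho> W m y\<bar>" by (simp add: g_def)
    then show ?thesis
      using ennreal_regularized_le[OF \<rho>, of W m y] Wnn by (simp add: order_trans[OF ennreal_leI])
  qed
  \<comment> \<open>Cutting \<open>W\<close> off outside \<open>{- (2 * s)..2 * s}\<close> gives it
    finite total mass; afterwards the integrals can be taken over the whole line.\<close>
  define w where "w z = ennreal (indicator {- (2 * s)..2 * s} z * W z)" for z
  have [measurable]: "w \<in> borel_measurable borel" by (simp add: w_def[abs_def])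
  have pt: "ennreal \<bar>regularized \<rho> P n x * regularized \<rho> g n x * \<phi> x\<bar> \<le>
    ennreal (M * K) * (\<integral>\<^sup>+y. (\<integral>\<^sup>+z. w z * ennreal (?d m (y - z)) \<partial>lborel) * ennreal (?d n (x - y)) \<partial>lborel)"
    (is "_ \<le> _ * ?J") for x
  proof (cases "\<bar>x\<bar> > s")
    case False
    have "ennreal \<bar>regularized \<rho> g n x\<bar> \<le>
      (\<integral>\<^sup>+y. (\<integral>\<^sup>+z. ennreal (W z) * ennreal (?d m (y - z)) \<partial>lborel) * ennreal (?d n (x - y)) \<partial>lborel)"
      by (rule order_trans[OF ennreal_regularized_le[OF \<rho>]])
         (intro nn_integral_mono mult_right_mono g, simp)
    also have "\<dots> \<le> ?J"
    proof (rule nn_integral_mono)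
      fix y
      show "(\<integral>\<^sup>+z. ennreal (W z) * ennreal (?d m (y - z)) \<partial>lborel) * ennreal (?d n (x - y)) \<le>
        (\<integral>\<^sup>+z. w z * ennreal (?d m (y - z)) \<partial>lborel) * ennreal (?d n (x - y))"
      proof (cases "?d n (x - y) = 0")
        case n: False
        have "ennreal (W z) * ennreal (?d m (y - z)) \<le> w z * ennreal (?d m (y - z))" for z
        proof (cases "?d m (y - z) = 0")
          case m: False
          have "\<bar>z\<bar> \<le> 2 * s"
            using delta_seq_support[OF \<rho> m] delta_seq_support[OF \<rho> n] small False by linarith
          then have "z \<in> {- (2 * s)..2 * s}" by auto
          then show ?thesis by (simp add: w_def)
        qed simp
        then show ?thesis by (rule mult_right_mono[OF nn_integral_mono]) simp
      qed simp
    qed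
    finally have J: "ennreal \<bar>regularized \<rho> g n x\<bar> \<le> ?J" .
    have "\<bar>regularized \<rho> P n x\<bar> * \<bar>\<phi> x\<bar> \<le> M * K"
      by (intro mult_mono regularized_bounded[OF \<rho> pos(2) P] \<phi> P) simp
    then have "ennreal (\<bar>regularized \<rho> P n x\<bar> * \<bar>\<phi> x\<bar>) * ennreal \<bar>regularized \<rho> g n x\<bar> \<le> ennreal (M * K) * ?J"
      by (intro mult_mono[OF ennreal_leI J]) auto
    then show ?thesis
      by (simp add: abs_mult ennreal_mult[symmetric] mult_ac)
  qed (simp add: \<phi>(3))
  have W_int: "integrable lborel (\<lambda>z. indicator {- (2 * s)..2 * s} z * W z)"
    using W by (auto simp: locally_integrable_def set_integrable_def)
  have "ennreal \<bar>LINT x|lborel. regularized \<rho> P n x * regularized \<rho> g n x * \<phi> x\<bar> \<le>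
    (\<integral>\<^sup>+x. ennreal (M * K) * (\<integral>\<^sup>+y. (\<integral>\<^sup>+z. w z * ennreal (?d m (y - z)) \<partial>lborel) * ennreal (?d n (x - y)) \<partial>lborel) \<partial>lborel)"
    by (rule order_trans[OF abs_integral_le_nn_integral nn_integral_mono[OF pt]])
  also have "\<dots> = ennreal (M * K) * (\<integral>\<^sup>+x. (\<integral>\<^sup>+y. (\<integral>\<^sup>+z. w z * ennreal (?d m (y - z)) \<partial>lborel) * ennreal (?d n (x - y)) \<partial>lborel) \<partial>lborel)"
    by (rule nn_integral_cmult) measurable
  \<comment> \<open>Mass conservation removes \<open>?d n\<close> first and then
    \<open>?d m\<close>.\<close>
  also have "\<dots> = ennreal (M * K) * (\<integral>\<^sup>+z. w z \<partial>lborel)"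
    by (simp add: nn_integral_convolution_delta_seq[OF \<rho>] pos)
  also have "(\<integral>\<^sup>+z. w z \<partial>lborel) = ennreal (LINT x:{- (2 * s)..2 * s}|lborel. W x)"
    unfolding w_def using W_int Wnn
    by (subst nn_integral_eq_integral) (auto simp: set_lebesgue_integral_def)
  also have "ennreal (M * K) * \<dots> = ennreal (M * K * (LINT x:{- (2 * s)..2 * s}|lborel. W x))"
    using P \<phi> Wnn
    by (intro ennreal_mult[symmetric]) (auto simp: set_lebesgue_integral_def)
  finally show ?thesis
    using P \<phi> Wnn unfolding g_def
    by (subst (asm) ennreal_le_iff) (auto simp: set_lebesgue_integral_def)
qed

text \<open>The uniform bound holds eventually in \<open>m\<close> for each large \<open>n\<close>,
  and so survives both limits. The test function enters through its sup norm and support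
  only.\<close>

lemma has_composition_bound:
  assumes \<rho>: "mollifier \<rho>" and "\<omega> > 0" and P: "M \<ge> 0" "\<And>x. \<bar>P x\<bar> \<le> M"
    and R: "locally_integrable UNIV R" "\<And>x. x \<noteq> 0 \<Longrightarrow> R x > 0"
    and Q: "\<And>x. x \<noteq> 0 \<Longrightarrow> Q x > 0"
    and W: "locally_integrable UNIV (\<lambda>x. R x powr (- \<omega>))"
    and h: "has_composition \<rho> I P R Q \<omega> h"
    and \<phi>: "test_function I \<phi>" "K \<ge> 0" "\<And>x. \<bar>\<phi> x\<bar> \<le> K" "\<And>x. \<bar>x\<bar> > s \<Longrightarrow> \<phi> x = 0" and "s > 0"
  shows "\<bar>h \<phi>\<bar> \<le> M * K * (LINT x:{- (2 * s)..2 * s}|lborel. R x powr (- \<omega>))" (is "_ \<le> ?B")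
proof -
  have large: "\<forall>\<^sub>F n in sequentially. 2 / s < real n"
    using filterlim_real_sequentially eventually_gt_at_top filterlim_iff by blast
  obtain L where
    inner: "\<forall>\<^sub>F n in sequentially. (\<lambda>m. LINT x|lborel. regularized \<rho> P n x *
           regularized \<rho>
             (\<lambda>y. (regularized \<rho> R m y + regularized \<rho> Q m y * delta_seq \<rho> m y) powr (- \<omega>)) n x *
           \<phi> x) \<longlonglongrightarrow> L n"
    and L: "L \<longlonglongrightarrow> h \<phi>"
    using h \<phi>(1) unfolding has_composition_def by blast
  have "\<forall>\<^sub>F n in sequentially. \<bar>L n\<bar> \<le> ?B"
    using inner large
  proof eventually_elim
    case (elim n)
    have "\<forall>\<^sub>F m in sequentially. \<bar>LINT x|lborel. regularized \<rho> P n x *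
           regularized \<rho>
             (\<lambda>y. (regularized \<rho> R m y + regularized \<rho> Q m y * delta_seq \<rho> m y) powr (- \<omega>)) n x *
           \<phi> x\<bar> \<le> ?B"
      using large
    proof eventually_elim
      case m: (elim m)
      show ?case
        by (rule abs_regularized_integral_le[OF \<rho> \<open>\<omega> > 0\<close> P R Q W \<phi>(2-4) m elim(2) \<open>s > 0\<close>])
    qed
    then show ?case
      by (rule tendsto_upperbound[OF tendsto_rabs[OF elim(1)]]) simp
  qed
  then show ?thesis
    by (rule tendsto_upperbound[OF tendsto_rabs[OF L]]) simp
qed

section \<open>Limits along shrinking bumps\<close>

text \<open>Dominated convergence: the intervals shrink to at most the null set
  \<open>{0}\<close>.\<close>

lemma set_integral_shrinking_tendsto_0:
  fixes g :: "real \<Rightarrow> real"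
  assumes g: "set_integrable lborel {- d..d} g" and "d > 0"
    and e: "e \<longlonglongrightarrow> 0"
  shows "(\<lambda>k::nat. LINT x:{- e k..e k}|lborel. g x) \<longlonglongrightarrow> 0"
proof -
  have "\<forall>\<^sub>F k in sequentially. e k < d" using order_tendstoD(2)[OF e \<open>d > 0\<close>] .
  \<comment> \<open>The minimum with \<open>d\<close> leaves the integral unchanged for large
    \<open>k\<close>; the factor restricting \<open>g\<close> to \<open>{- d..d}\<close> supplies
    the same integrable majorant for all \<open>k\<close>.\<close>
  then have ev: "\<forall>\<^sub>F k in sequentially.
      (LINT x|lborel. indicator {- min (e k) d..min (e k) d} x * (indicator {- d..d} x * g x)) =
      (LINT x:{- e k..e k}|lborel. g x)"
  proof eventually_elim
    case (elim k)
    then show ?case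
      unfolding set_lebesgue_integral_def
      by (intro Bochner_Integration.integral_cong) (auto simp: indicator_def)
  qed
  have int: "integrable lborel (\<lambda>x. indicator {- d..d} x * g x)"
    using g by (simp add: set_integrable_def)
  have "(\<lambda>k. LINT x|lborel. indicator {- min (e k) d..min (e k) d} x * (indicator {- d..d} x * g x))
      \<longlonglongrightarrow> integral\<^sup>L lborel (\<lambda>x::real. 0 :: real)"
  proof (rule integral_dominated_convergence)
    have "AE x in lborel. x \<noteq> (0::real)" by (rule AE_lborel_singleton)
    then show "AE x in lborel. (\<lambda>k. indicator {- min (e k) d..min (e k) d} x * (indicator {- d..d} x * g x)) \<longlonglongrightarrow> 0"
    proof eventually_elim
      case (elim x)
      then have "\<forall>\<^sub>F k in sequentially. e k < \<bar>x\<bar>" using order_tendstoD(2)[OF e] by simp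
      then have "\<forall>\<^sub>F k in sequentially. 0 = indicator {- min (e k) d..min (e k) d} x * (indicator {- d..d} x * g x)"
        by eventually_elim (auto simp: indicator_def)
      then show ?case by (rule Lim_transform_eventually[rotated]) simp
    qed
    show "integrable lborel (\<lambda>x. \<bar>indicator {- d..d} x * g x\<bar>)"
      using int by (rule integrable_abs)
    show "(\<lambda>x. indicator {- min (e k) d..min (e k) d} x * (indicator {- d..d} x * g x)) \<in> borel_measurable lborel" for k
      by (rule borel_measurable_times[OF _ borel_measurable_integrable[OF int]]) simp
  qed (auto simp: indicator_def)
  from Lim_transform_eventually[OF this ev] show ?thesis by simp
qed

text \<open>The value is at most \<open>K\<close> times the integral of \<open>g\<close> over
  \<open>{- e k..e k}\<close>. Passing through nonnegative integrals places the integrability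
  requirement on the majorant \<open>g\<close>.\<close>

lemma regular_dist_shrinking_tendsto_0:
  fixes g :: "real \<Rightarrow> real"
  assumes g: "set_integrable lborel {- d..d} g" and "d > 0"
    and dom: "\<And>x. \<bar>x\<bar> \<le> d \<Longrightarrow> \<bar>f x\<bar> \<le> g x"
    and e: "e \<longlonglongrightarrow> 0"
    and \<phi>: "\<And>k x. \<bar>\<phi> k x\<bar> \<le> K" "\<And>k x. \<bar>x\<bar> > e k \<Longrightarrow> \<phi> k x = 0"
  shows "(\<lambda>k::nat. regular_dist f (\<phi> k)) \<longlonglongrightarrow> 0"
proof (rule Lim_null_comparison)
  have "\<bar>\<phi> 0 0\<bar> \<le> K" by (rule \<phi>)
  then have K: "K \<ge> 0" by linarith
  show "(\<lambda>k. K * (LINT x:{- e k..e k}|lborel. g x)) \<longlonglongrightarrow> 0"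
    using tendsto_mult_right_zero[OF set_integral_shrinking_tendsto_0[OF g \<open>d > 0\<close> e]] by simp
  have "\<forall>\<^sub>F k in sequentially. e k < d" using order_tendstoD(2)[OF e \<open>d > 0\<close>] .
  then show "\<forall>\<^sub>F k in sequentially. norm (regular_dist f (\<phi> k)) \<le> K * (LINT x:{- e k..e k}|lborel. g x)"
  proof eventually_elim
    case (elim k)
    have gnn: "0 \<le> indicator {- e k..e k} x * g x" for x
    proof (cases "\<bar>x\<bar> \<le> e k")
      case True
      then have "\<bar>f x\<bar> \<le> g x" using elim by (intro dom) simp
      then show ?thesis by (simp add: indicator_def)
    qed (auto simp: indicator_def)
    have "set_integrable lborel {- e k..e k} g"
      by (rule set_integrable_subset[OF g]) (use elim in auto)
    then have int: "integrable lborel (\<lambda>x. indicator {- e k..e k} x * g x)"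
      by (simp add: set_integrable_def)
    have "ennreal \<bar>regular_dist f (\<phi> k)\<bar> \<le> (\<integral>\<^sup>+x. ennreal \<bar>f x * \<phi> k x\<bar> \<partial>lborel)"
      unfolding regular_dist_def by (rule abs_integral_le_nn_integral)
    also have "\<dots> \<le> (\<integral>\<^sup>+x. ennreal (K * (indicator {- e k..e k} x * g x)) \<partial>lborel)"
    proof (rule nn_integral_mono)
      fix x
      show "ennreal \<bar>f x * \<phi> k x\<bar> \<le> ennreal (K * (indicator {- e k..e k} x * g x))"
      proof (cases "\<bar>x\<bar> > e k")
        case False
        then have "x \<in> {- e k..e k}" "\<bar>f x\<bar> \<le> g x" using dom[of x] elim by auto
        then show ?thesis
          using \<phi>(1)[of k x] K
          by (auto simp: abs_mult mult.commute[of K] intro!: ennreal_leI mult_mono)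
      qed (simp add: \<phi>(2))
    qed
    also have "\<dots> = ennreal (K * (LINT x:{- e k..e k}|lborel. g x))"
      using int gnn K
      by (subst nn_integral_eq_integral) (auto simp: set_lebesgue_integral_def)
    finally have "ennreal \<bar>regular_dist f (\<phi> k)\<bar> \<le> ennreal (K * (LINT x:{- e k..e k}|lborel. g x))" .
    moreover have "0 \<le> (LINT x:{- e k..e k}|lborel. g x)"
      unfolding set_lebesgue_integral_def by (rule Bochner_Integration.integral_nonneg) (simp add: gnn)
    ultimately show ?case using K by simp
  qed
qed

text \<open>The limits say nothing about the value at 0, so \<open>\<bar>f 0\<bar>\<close> is added
  to the bound. In the application it is the value of \<open>hubble\<close> at the kink of the scale
  factor, where \<open>deriv\<close> has no useful meaning.\<close>

lemma one_sided_limits_bounded_near_0: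
  fixes f :: "real \<Rightarrow> real"
  assumes "(f \<longlongrightarrow> l) (at_right 0)" "(f \<longlongrightarrow> l') (at_left 0)" "r > 0"
  obtains d C where "d > 0" "d < r" "\<And>x. \<bar>x\<bar> \<le> d \<Longrightarrow> \<bar>f x\<bar> \<le> C"
proof -
  have "\<forall>\<^sub>F x in at_right 0. \<bar>f x\<bar> < \<bar>l\<bar> + 1"
    by (rule order_tendstoD(2)[OF tendsto_rabs[OF assms(1)]]) simp
  moreover have "\<forall>\<^sub>F x in at_left 0. \<bar>f x\<bar> < \<bar>l'\<bar> + 1"
    by (rule order_tendstoD(2)[OF tendsto_rabs[OF assms(2)]]) simp
  ultimately have "\<forall>\<^sub>F x in at 0. \<bar>f x\<bar> \<le> \<bar>l\<bar> + \<bar>l'\<bar> + 1"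
    unfolding eventually_at_split by (auto elim!: eventually_mono)
  then obtain d where d: "d > 0" "\<And>x. x \<noteq> 0 \<Longrightarrow> \<bar>x\<bar> < d \<Longrightarrow> \<bar>f x\<bar> \<le> \<bar>l\<bar> + \<bar>l'\<bar> + 1"
    by (auto simp: eventually_at dist_real_def)
  have "\<bar>f x\<bar> \<le> \<bar>l\<bar> + \<bar>l'\<bar> + 1 + \<bar>f 0\<bar>" if "\<bar>x\<bar> < d" for x
    using d(2)[OF _ that] by (cases "x = 0") auto
  then show ?thesis
    by (intro that[of "min d r / 2" "\<bar>l\<bar> + \<bar>l'\<bar> + 1 + \<bar>f 0\<bar>"]) (use d assms(3) in auto)
qed

lemma smooth_integral_deriv:
  assumes "smooth \<psi>" "a \<le> b"
  shows "integrable lborel (\<lambda>x. deriv \<psi> x * indicator {a..b} x)"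
    and "(LINT x|lborel. deriv \<psi> x * indicator {a..b} x) = \<psi> b - \<psi> a"
proof -
  have "isCont (deriv \<psi>) x" for x
    using smooth_has_deriv[OF smooth_deriv[OF assms(1)]] by (rule DERIV_isCont)
  then have "has_bochner_integral lborel (\<lambda>x. deriv \<psi> x * indicator {a..b} x) (\<psi> b - \<psi> a)"
    by (intro has_bochner_integral_FTC_Icc_real assms) (auto simp: smooth_has_deriv[OF assms(1)])
  then show "integrable lborel (\<lambda>x. deriv \<psi> x * indicator {a..b} x)"
    "(LINT x|lborel. deriv \<psi> x * indicator {a..b} x) = \<psi> b - \<psi> a"
    by (auto simp: has_bochner_integral_iff)
qed

text \<open>Substituting \<open>x = e k * u\<close> cancels the factor \<open>1 / e k\<close> of the
  derivative. Then \<open>F (e k * u)\<close> tends to \<open>l\<close> for \<open>u > 0\<close> and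
  to \<open>l'\<close> for \<open>u < 0\<close>, and integrating \<open>deriv \<psi>\<close> over
  each half leaves the jump times \<open>\<psi> 0\<close>.\<close>

lemma regular_dist_deriv_rescaled_tendsto:
  assumes \<psi>: "smooth \<psi>" "\<And>x. \<bar>x\<bar> \<ge> 1 \<Longrightarrow> \<psi> x = 0"
    and "r > 0" and cont: "continuous_on ({- r<..<r} - {0}) F"
    and lim: "(F \<longlongrightarrow> l) (at_right 0)" "(F \<longlongrightarrow> l') (at_left 0)"
    and e: "e \<longlonglongrightarrow> 0" "\<And>k::nat. e k > 0"
  shows "(\<lambda>k. regular_dist F (deriv (\<lambda>x. \<psi> (x / e k)))) \<longlonglongrightarrow> (l' - l) * \<psi> 0"
proof -
  have e_nz: "e k \<noteq> 0" for k using e(2)[of k] by simp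
  have D: "deriv (\<lambda>x. \<psi> (x / e k)) x = deriv \<psi> (x / e k) / e k" for k x
    using deriv_funpow_affine[OF \<psi>(1), of 1 "1 / e k" 0] by simp
  have z: "deriv \<psi> x = 0" if "\<bar>x\<bar> > 1" for x
  proof -
    have "(\<psi> has_real_derivative 0) (at x)"
    proof (rule has_field_derivative_transform_within[OF DERIV_const[of 0]])
      show "\<bar>x\<bar> - 1 > 0" using that by simp
      show "0 = \<psi> y" if "dist y x < \<bar>x\<bar> - 1" for y
        using that by (intro \<psi>(2)[symmetric]) (auto simp: dist_real_def)
    qed simp
    then show ?thesis by (rule DERIV_imp_deriv)
  qed
  have cont': "continuous_on UNIV (deriv \<psi>)" by (intro smooth_continuous smooth_deriv \<psi>)
  obtain N where N: "N > 0" "\<And>x. \<bar>deriv \<psi> x\<bar> \<le> N"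
    using continuous_compact_support_bounded[OF cont' z] by blast
  obtain d C where d: "d > 0" "d < r" "\<And>x. \<bar>x\<bar> \<le> d \<Longrightarrow> \<bar>F x\<bar> \<le> C"
    using one_sided_limits_bounded_near_0[OF lim \<open>r > 0\<close>] by blast
  have "\<bar>F d\<bar> \<le> C" using d(3)[of d] d(1) by simp
  then have C: "C \<ge> 0" by linarith
  \<comment> \<open>\<open>F\<close> is controlled only near 0; its truncation \<open>G\<close> is
    bounded everywhere and agrees with \<open>F\<close> on the support of the bump once
    \<open>e k < d\<close>.\<close>
  define G where "G x = indicator {- d<..<d} x * F x" for x
  have "continuous_on ({- d<..<d} - {0}) F"
    by (rule continuous_on_subset[OF cont]) (use d(2) in auto)
  then have [measurable]: "(\<lambda>x. indicator ({- d<..<d} - {0}) x * F x) \<in> borel_measurable borel"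
    using borel_measurable_continuous_on_indicator[of "{- d<..<d} - {0}" F] by simp
  \<comment> \<open>Continuity of \<open>F\<close> is given only off 0, so the point 0 is split off
    for measurability.\<close>
  have "G = (\<lambda>x. indicator ({- d<..<d} - {0}) x * F x + indicator {0} x * F 0)"
    using d(1) by (auto simp: G_def indicator_def)
  then have [measurable]: "G \<in> borel_measurable borel" by simp
  have [measurable]: "deriv \<psi> \<in> borel_measurable borel"
    by (rule borel_measurable_continuous_onI[OF cont'])
  have G: "\<bar>G x\<bar> \<le> C" for x
    using d(3)[of x] C by (auto simp: G_def indicator_def)
  let ?g = "\<lambda>u. l * (deriv \<psi> u * indicator {0..1} u) + l' * (deriv \<psi> u * indicator {-1..0} u)"
  have "(\<lambda>k. LINT u|lborel. G (e k * u) * deriv \<psi> u) \<longlonglongrightarrow> (LINT u|lborel. ?g u)"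
  proof (rule integral_dominated_convergence)
    show "integrable lborel (\<lambda>u. C * N * indicator {-1..1::real} u)"
      by (intro integrable_mult_right integrable_real_indicator) (auto intro: emeasure_compact_finite)
    show "AE u in lborel. norm (G (e k * u) * deriv \<psi> u) \<le> C * N * indicator {-1..1} u" for k
    proof (rule AE_I2)
      fix u
      show "norm (G (e k * u) * deriv \<psi> u) \<le> C * N * indicator {-1..1} u"
        using mult_mono[OF G[of "e k * u"] N(2)[of u] C] z[of u]
        by (cases "\<bar>u\<bar> > 1") (auto simp: abs_mult indicator_def)
    qed
    show "AE u in lborel. (\<lambda>k. G (e k * u) * deriv \<psi> u) \<longlonglongrightarrow> ?g u"
      using AE_lborel_singleton[of 0]
    proof eventually_elim
      case (elim u)
      have eu: "(\<lambda>k. e k * u) \<longlonglongrightarrow> 0" using tendsto_mult_left_zero[OF e(1)] by simp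
      have near: "\<forall>\<^sub>F k in sequentially. \<bar>e k * u\<bar> < d"
        using order_tendstoD(2)[OF tendsto_rabs[OF eu]] d(1) by simp
      have ev: "\<forall>\<^sub>F k in sequentially. F (e k * u) = G (e k * u)"
        using near by eventually_elim (use elim e(2) in \<open>auto simp: G_def indicator_def less_le\<close>)
      show ?case
      proof (cases "u > 0")
        case True
        have "filterlim (\<lambda>k. e k * u) (at_right 0) sequentially"
          unfolding filterlim_at using eu True e(2) by (simp add: e_nz)
        from Lim_transform_eventually[OF filterlim_compose[OF lim(1) this] ev]
        have "(\<lambda>k. G (e k * u) * deriv \<psi> u) \<longlonglongrightarrow> l * deriv \<psi> u" by (intro tendsto_intros)
        then show ?thesis using True z[of u] by (auto simp: indicator_def)
      next
        case False
        then have u: "u < 0" using elim by simp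
        have "filterlim (\<lambda>k. e k * u) (at_left 0) sequentially"
          unfolding filterlim_at using eu u e(2) by (simp add: mult_pos_neg e_nz)
        from Lim_transform_eventually[OF filterlim_compose[OF lim(2) this] ev]
        have "(\<lambda>k. G (e k * u) * deriv \<psi> u) \<longlonglongrightarrow> l' * deriv \<psi> u" by (intro tendsto_intros)
        then show ?thesis using u z[of u] by (auto simp: indicator_def)
      qed
    qed
  qed measurable
  also have "(LINT u|lborel. ?g u) = l * (\<psi> 1 - \<psi> 0) + l' * (\<psi> 0 - \<psi> (-1))"
    using smooth_integral_deriv[OF \<psi>(1), of 0 1] smooth_integral_deriv[OF \<psi>(1), of "-1" 0] by simp
  also have "\<dots> = (l' - l) * \<psi> 0"
    by (simp add: \<psi>(2) algebra_simps)
  finally have main: "(\<lambda>k. LINT u|lborel. G (e k * u) * deriv \<psi> u) \<longlonglongrightarrow> (l' - l) * \<psi> 0" .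
  have "\<forall>\<^sub>F k in sequentially. e k < d" using order_tendstoD(2)[OF e(1) d(1)] .
  then have "\<forall>\<^sub>F k in sequentially. (LINT u|lborel. G (e k * u) * deriv \<psi> u) =
      regular_dist F (deriv (\<lambda>x. \<psi> (x / e k)))"
  proof eventually_elim
    case (elim k)
    have "(LINT x|lborel. F x * (deriv \<psi> (x / e k) / e k)) =
        \<bar>e k\<bar> *\<^sub>R (LINT u|lborel. F (0 + e k * u) * (deriv \<psi> ((0 + e k * u) / e k) / e k))"
      by (rule lborel_integral_real_affine) (use e(2)[of k] in simp)
    also have "\<dots> = (LINT u|lborel. F (e k * u) * deriv \<psi> u)"
      using e(2)[of k] by simp
    also have "\<dots> = (LINT u|lborel. G (e k * u) * deriv \<psi> u)"
    proof (rule Bochner_Integration.integral_cong[OF refl])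
      fix u
      show "F (e k * u) * deriv \<psi> u = G (e k * u) * deriv \<psi> u"
      proof (cases "\<bar>u\<bar> > 1")
        case False
        then have "\<bar>e k * u\<bar> \<le> e k" using e(2)[of k] by (simp add: abs_mult)
        then have "\<bar>e k * u\<bar> < d" using elim by simp
        then show ?thesis by (auto simp: G_def indicator_def)
      qed (simp add: z)
    qed
    finally show ?case by (simp add: regular_dist_def D)
  qed
  from Lim_transform_eventually[OF main this] show ?thesis .
qed

text \<open>A mollifier may vanish at 0, so it is recentred at a point \<open>c\<close> where it is
  positive. Since \<open>\<bar>c\<bar> < 1\<close>, compression by 2 keeps the support in range:
  \<open>\<bar>2 * x + c\<bar> > 1\<close> for \<open>\<bar>x\<bar> \<ge> 1\<close>.\<close>

lemma mollifier_bump: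
  assumes "mollifier \<rho>"
  obtains \<psi> where "smooth \<psi>" "\<And>x. \<bar>x\<bar> \<ge> 1 \<Longrightarrow> \<psi> x = 0" "\<psi> 0 > 0"
proof -
  have "\<exists>c. \<rho> c > 0"
  proof (rule ccontr)
    assume "\<nexists>c. \<rho> c > 0"
    then have "(\<integral>\<^sup>+x. ennreal (\<rho> x) \<partial>lborel) = 0"
      by (simp add: ennreal_neg not_less)
    then show False using nn_integral_mollifier[OF assms] by simp
  qed
  then obtain c where c: "\<rho> c > 0" by blast
  have supp: "\<rho> x = 0" if "\<bar>x\<bar> \<ge> 1" for x using assms that by (simp add: mollifier_def)
  have "\<bar>c\<bar> < 1" using supp[of c] c by force
  then have "\<rho> (2 * x + c) = 0" if "\<bar>x\<bar> \<ge> 1" for x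
    using that by (intro supp) auto
  moreover have "smooth (\<lambda>x. \<rho> (2 * x + c))"
    using assms by (intro smooth_affine) (simp add: mollifier_def)
  ultimately show ?thesis
    using c by (intro that[of "\<lambda>x. \<rho> (2 * x + c)"]) auto
qed

section \<open>Extrinsic curvature and junction conditions for the flat metric\<close>

text \<open>The coefficient is exactly the quantity \<open>H a^2\<close> differentiated in the field
  equation, which is why the jump found there is a jump of the extrinsic curvature.\<close>

lemma extrinsic_curvature_flat_metric:
  assumes "a differentiable at t" "a t \<noteq> 0"
  shows "extrinsic_curvature (flat_metric a) t = (hubble a t * (a t)\<^sup>2) *\<^sub>R mat 1"
proof -
  have "(a has_real_derivative deriv a t) (at t)"
    using assms(1) by (simp add: DERIV_deriv_iff_real_differentiable)
  then have "((\<lambda>s. (a s)\<^sup>2) has_real_derivative 2 * a t * deriv a t) (at t)"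
    by (auto intro!: derivative_eq_intros)
  then have "deriv (\<lambda>s. (a s)\<^sup>2) t = 2 * a t * deriv a t" by (rule DERIV_imp_deriv)
  then show ?thesis
    using assms(2)
    by (simp add: vec_eq_iff extrinsic_curvature_def flat_metric_def mat_def hubble_def power2_eq_square)
qed

text \<open>\<open>matrix_inv\<close> is a choice, so both existence and uniqueness of the two-sided
  inverse enter.\<close>

lemma matrix_inv_scaleR_mat:
  fixes c :: real
  assumes "c \<noteq> 0"
  shows "matrix_inv (c *\<^sub>R (mat 1 :: real ^ 'n ^ 'n)) = (1 / c) *\<^sub>R mat 1"
  unfolding matrix_inv_def
proof (rule some_equality)
  fix A :: "real ^ 'n ^ 'n"
  assume "(c *\<^sub>R mat 1) ** A = mat 1 \<and> A ** (c *\<^sub>R mat 1) = mat 1"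
  then have "c *\<^sub>R A = mat 1" by (simp add: scalar_matrix_assoc[symmetric])
  then have "(1 / c) *\<^sub>R (c *\<^sub>R A) = (1 / c) *\<^sub>R mat 1" by (rule arg_cong)
  then show "A = (1 / c) *\<^sub>R mat 1" using assms by simp
qed (use assms in \<open>simp add: scalar_matrix_assoc[symmetric] matrix_scalar_ac\<close>)

text \<open>With \<open>[H] = H_2 - H_1\<close> the jump of the curvature is
  \<open>[H] \<gamma>\<close> and its trace is \<open>3 [H]\<close>, so the left side is
  \<open>-2 [H] \<gamma>\<close>; for \<open>[H] = -(3/2) p\<close> this is
  \<open>3 p \<gamma>\<close>.\<close>

lemma flat_metric_second_junction_condition:
  assumes lim: "(hubble a \<longlongrightarrow> H\<^sub>1) (at_left s)" "(hubble a \<longlongrightarrow> H\<^sub>2) (at_right s)"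
    and cont: "isCont a s" and "a s \<noteq> 0"
    and ev: "\<forall>\<^sub>F t in at s. a differentiable at t \<and> a t \<noteq> 0"
    and jump: "H\<^sub>2 - H\<^sub>1 = - (3/2) * p"
  shows "second_junction_condition (flat_metric a) s (p *\<^sub>R flat_metric a s)"
proof -
  let ?c = "(a s)\<^sup>2" and ?I = "mat 1 :: real ^ 3 ^ 3"
  have K: "(extrinsic_curvature (flat_metric a) \<longlongrightarrow> (H * ?c) *\<^sub>R ?I) (at s within S)"
    if "(hubble a \<longlongrightarrow> H) (at s within S)" for H S
  proof -
    have "(a \<longlongrightarrow> a s) (at s within S)"
      using cont by (auto simp: isCont_def intro: tendsto_within_subset)
    then have l: "((\<lambda>t. (hubble a t * (a t)\<^sup>2) *\<^sub>R ?I) \<longlongrightarrow> (H * ?c) *\<^sub>R ?I) (at s within S)"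
      by (intro tendsto_intros that)
    have "\<forall>\<^sub>F t in at s within S. a differentiable at t \<and> a t \<noteq> 0"
      using ev filter_leD[OF at_le[of S UNIV s]] by auto
    then have "\<forall>\<^sub>F t in at s within S.
        (hubble a t * (a t)\<^sup>2) *\<^sub>R ?I = extrinsic_curvature (flat_metric a) t"
      by eventually_elim (simp add: extrinsic_curvature_flat_metric)
    from Lim_transform_eventually[OF l this] show ?thesis .
  qed
  have inv: "matrix_inv (?c *\<^sub>R ?I) = (1 / ?c) *\<^sub>R ?I"
    using \<open>a s \<noteq> 0\<close>
    by (intro matrix_inv_scaleR_mat) simp
  have tr: "trace (x *\<^sub>R ?I) = 3 * x" for x
    by (simp add: trace_def mat_def sum_3)
  have diff: "(H\<^sub>2 * ?c) *\<^sub>R ?I - (H\<^sub>1 * ?c) *\<^sub>R ?I = (- (3/2) * p * ?c) *\<^sub>R ?I"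
    by (simp only: jump[symmetric] scaleR_diff_left[symmetric] left_diff_distrib)
  have "matrix_inv (?c *\<^sub>R ?I) ** ((- (3/2) * p * ?c) *\<^sub>R ?I) = (- (3/2) * p) *\<^sub>R ?I"
    using \<open>a s \<noteq> 0\<close> by (simp add: inv scalar_matrix_assoc[symmetric] matrix_scalar_ac)
  then have "((H\<^sub>2 * ?c) *\<^sub>R ?I - (H\<^sub>1 * ?c) *\<^sub>R ?I) -
      trace (matrix_inv (flat_metric a s) ** ((H\<^sub>2 * ?c) *\<^sub>R ?I - (H\<^sub>1 * ?c) *\<^sub>R ?I)) *\<^sub>R flat_metric a s
      = 3 *\<^sub>R (p *\<^sub>R flat_metric a s)"
    unfolding diff flat_metric_def by (simp only: tr) (simp add: vec_eq_iff)
  then show ?thesis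
    unfolding second_junction_condition_def using K[OF lim(1)] K[OF lim(2)] by blast
qed

section \<open>Evaluation of the field equation on the bumps\<close>

theorem mainTheorem2:
  fixes A B \<rho>\<^sub>m\<^sub>0 a\<^sub>S H\<^sub>S t\<^sub>S r p\<^sub>\<delta> \<omega> :: real
    and a p P Q R \<rho> :: "real \<Rightarrow> real"
    and \<rho>ACh_a2 :: functional
    and I :: "real set"
  assumes "A > 0" "B > 0" "\<rho>\<^sub>m\<^sub>0 > 0"
    and "a\<^sub>S = (B / A) powr (1/6)"
    and "H\<^sub>S = sqrt (\<rho>\<^sub>m\<^sub>0 / a\<^sub>S ^ 3)"
    and "soft_singularity a t\<^sub>S r" "a t\<^sub>S = a\<^sub>S"
    and "I = {- r<..<r}"
    and "locally_integrable I p"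
    and pressure: "dist_eq I
      (\<lambda>\<phi>. regular_dist p \<phi> + p\<^sub>\<delta> * delta \<phi>)
      (\<lambda>\<phi>. regular_dist (\<lambda>\<tau>. sqrt (A / (6 * H\<^sub>S * \<bar>\<tau>\<bar>))) \<phi> + 4/3 * H\<^sub>S * delta \<phi>)"
    and "mollifier \<rho>"
    and "\<omega> > 0"
    and "P \<in> borel_measurable borel" "bounded (range P)"
    and "locally_integrable UNIV R" "\<And>\<tau>. \<tau> \<noteq> 0 \<Longrightarrow> R \<tau> > 0"
    and "locally_integrable UNIV Q" "\<And>\<tau>. \<tau> \<noteq> 0 \<Longrightarrow> Q \<tau> > 0"
    and "locally_integrable UNIV (\<lambda>\<tau>. R \<tau> powr (- \<omega>))"
    and "distribution I \<rho>ACh_a2"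
    and "has_composition \<rho> I P R Q \<omega> \<rho>ACh_a2"
    (* with \<tau> = t\<^sub>S - t, the derivative along t is minus the one along \<tau> *)
    and equation: "dist_eq I
      (\<lambda>\<phi>. - dist_deriv (regular_dist (\<lambda>\<tau>. hubble a (t\<^sub>S - \<tau>) * (a (t\<^sub>S - \<tau>))\<^sup>2)) \<phi>)
      (\<lambda>\<phi>. - regular_dist (\<lambda>\<tau>. (hubble a (t\<^sub>S - \<tau>))\<^sup>2 * (a (t\<^sub>S - \<tau>))\<^sup>2) \<phi> +
            3/2 * (regular_dist (\<lambda>\<tau>. \<rho>\<^sub>m\<^sub>0 / (a (t\<^sub>S - \<tau>)) ^ 3 * (a (t\<^sub>S - \<tau>))\<^sup>2) \<phi> + \<rho>ACh_a2 \<phi>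
                   - regular_dist (\<lambda>\<tau>. p \<tau> * (a (t\<^sub>S - \<tau>))\<^sup>2) \<phi>
                   - p\<^sub>\<delta> * times_delta (\<lambda>\<tau>. (a (t\<^sub>S - \<tau>))\<^sup>2) \<phi>))"
  shows "jump (hubble a) t\<^sub>S = - (3/2) * p\<^sub>\<delta>
    \<and> second_junction_condition (flat_metric a) t\<^sub>S (p\<^sub>\<delta> *\<^sub>R flat_metric a t\<^sub>S)
    \<and> joinable (flat_metric a) t\<^sub>S (p\<^sub>\<delta> *\<^sub>R flat_metric a t\<^sub>S)"
proof -
  note \<rho> = \<open>mollifier \<rho>\<close> and R = \<open>locally_integrable UNIV R\<close> \<open>\<And>\<tau>. \<tau> \<noteq> 0 \<Longrightarrow> R \<tau> > 0\<close>
    and Q = \<open>\<And>\<tau>. \<tau> \<noteq> 0 \<Longrightarrow> Q \<tau> > 0\<close> and W = \<open>locally_integrable UNIV (\<lambda>\<tau>. R \<tau> powr (- \<omega>))\<close>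
    and comp = \<open>has_composition \<rho> I P R Q \<omega> \<rho>ACh_a2\<close>
  let ?U = "{t\<^sub>S - r<..<t\<^sub>S + r}"
  obtain H\<^sub>1 H\<^sub>2 where "r > 0"
    and a_pos: "\<And>t. t \<in> ?U \<Longrightarrow> a t > 0" and a_cont: "continuous_on ?U a"
    and a_diff: "\<And>t. t \<in> ?U - {t\<^sub>S} \<Longrightarrow> a differentiable at t"
    and a'_cont: "continuous_on (?U - {t\<^sub>S}) (deriv a)"
    and H\<^sub>1: "(hubble a \<longlongrightarrow> H\<^sub>1) (at_left t\<^sub>S)" and H\<^sub>2: "(hubble a \<longlongrightarrow> H\<^sub>2) (at_right t\<^sub>S)"
    using \<open>soft_singularity a t\<^sub>S r\<close> unfolding soft_singularity_def
    by (elim conjE bexE exE) (rule that; (assumption | erule bspec))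
  have "a\<^sub>S > 0" using a_pos[of t\<^sub>S] \<open>r > 0\<close> \<open>a t\<^sub>S = a\<^sub>S\<close> by simp
  have a_isCont: "isCont a t\<^sub>S"
    using a_cont \<open>r > 0\<close> by (simp add: continuous_on_eq_continuous_at)

  define b where "b \<tau> = a (t\<^sub>S - \<tau>)" for \<tau>
  define h where "h \<tau> = hubble a (t\<^sub>S - \<tau>)" for \<tau>
  \<comment> \<open>Time is reversed: positive \<open>\<tau>\<close> lies before the singularity, so
    the limits from left and right change places.\<close>
  have h_lim: "(h \<longlongrightarrow> H\<^sub>1) (at_right 0)" "(h \<longlongrightarrow> H\<^sub>2) (at_left 0)"
  proof -
    have "((\<lambda>\<tau>. t\<^sub>S - \<tau>) \<longlongrightarrow> t\<^sub>S) (at 0 within S)" for S :: "real set"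
      by (auto intro!: tendsto_eq_intros)
    then have "filterlim (\<lambda>\<tau>. t\<^sub>S - \<tau>) (at_left t\<^sub>S) (at_right 0)"
      "filterlim (\<lambda>\<tau>. t\<^sub>S - \<tau>) (at_right t\<^sub>S) (at_left 0)"
      unfolding filterlim_at by (auto simp: eventually_at_filter)
    then show "(h \<longlongrightarrow> H\<^sub>1) (at_right 0)" "(h \<longlongrightarrow> H\<^sub>2) (at_left 0)"
      unfolding h_def[abs_def] using filterlim_compose[OF H\<^sub>1] filterlim_compose[OF H\<^sub>2] by auto
  qed
  have b_lim: "(b \<longlongrightarrow> a\<^sub>S) (at 0 within S)" for S
  proof -
    have "isCont b 0"
      unfolding b_def[abs_def] by (rule isCont_o2) (use a_isCont in auto)
    then show ?thesis
      using \<open>a t\<^sub>S = a\<^sub>S\<close> by (auto simp: isCont_def b_def intro: tendsto_within_subset)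
  qed
  have hb_cont: "continuous_on ({- r<..<r} - {0}) (\<lambda>\<tau>. h \<tau> * (b \<tau>)\<^sup>2)"
  proof -
    have "continuous_on (?U - {t\<^sub>S}) (\<lambda>t. hubble a t * (a t)\<^sup>2)"
      unfolding hubble_def
      by (intro continuous_intros a'_cont continuous_on_subset[OF a_cont]) (auto dest!: a_pos)
    then show ?thesis
      unfolding h_def b_def
      by (rule continuous_on_compose2) (auto intro!: continuous_intros)
  qed

  obtain \<psi> where \<psi>: "smooth \<psi>" "\<And>x. \<bar>x\<bar> \<ge> 1 \<Longrightarrow> \<psi> x = 0" "\<psi> 0 > 0"
    using mollifier_bump[OF \<rho>] by blast
  have "\<psi> x = 0" if "\<bar>x\<bar> > 1" for x using \<psi>(2) that by simp
  then obtain K where K: "K > 0" "\<And>x. \<bar>\<psi> x\<bar> \<le> K"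
    using continuous_compact_support_bounded[OF smooth_continuous[OF \<psi>(1)]] by blast
  \<comment> \<open>The factor \<open>r / 2\<close> keeps every support, including that for
    \<open>k = 0\<close>, strictly inside \<open>I\<close>.\<close>
  define e where "e k = r / 2 * inverse (real (Suc k))" for k
  have e_pos: "e k > 0" for k using \<open>r > 0\<close> by (simp add: e_def)
  have e_less: "e k < r" for k
  proof -
    have "r / 2 * inverse (real (Suc k)) \<le> r / 2 * 1"
      using \<open>r > 0\<close> by (intro mult_left_mono) (auto simp: field_simps)
    then show ?thesis using \<open>r > 0\<close> by (simp add: e_def)
  qed
  have e_lim: "e \<longlonglongrightarrow> 0"
    unfolding e_def[abs_def] using tendsto_mult_right_zero[OF LIMSEQ_inverse_real_of_nat] .
  define \<phi> where "\<phi> k x = \<psi> (x / e k)" for k x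
  have \<phi>_test: "test_function I (\<phi> k)" for k
    unfolding \<phi>_def[abs_def] \<open>I = {- r<..<r}\<close>
    by (rule test_function_rescale[OF \<psi>(1,2) e_pos[of k]]) (use e_less[of k] in auto)
  have \<phi>_bound: "\<bar>\<phi> k x\<bar> \<le> K" for k x by (simp add: \<phi>_def K)
  have \<phi>_supp: "\<phi> k x = 0" if "\<bar>x\<bar> > e k" for k x
    unfolding \<phi>_def using that e_pos[of k] by (intro \<psi>(2)) (simp add: field_simps)
  \<comment> \<open>One statement for all regular terms: \<open>f\<close> carries the integrable
    singularity and \<open>g\<close> is bounded near 0. The kinetic and dust terms take
    \<open>f = 1\<close>, the pressure term takes \<open>f = p\<close>.\<close>
  have vanish: "(\<lambda>k. regular_dist (\<lambda>\<tau>. f \<tau> * g \<tau>) (\<phi> k)) \<longlonglongrightarrow> 0"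
    if f: "locally_integrable I f" and g: "(g \<longlongrightarrow> l) (at_right 0)" "(g \<longlongrightarrow> l') (at_left 0)" for f g l l'
  proof -
    obtain d C where d: "d > 0" "d < r" "\<And>x. \<bar>x\<bar> \<le> d \<Longrightarrow> \<bar>g x\<bar> \<le> C"
      using one_sided_limits_bounded_near_0[OF g \<open>r > 0\<close>] by blast
    have "set_integrable lborel {- d..d} f"
      using f[unfolded locally_integrable_def, rule_format, of "{- d..d}"] d(2)
      by (simp add: subset_iff \<open>I = {- r<..<r}\<close>)
    then have "set_integrable lborel {- d..d} (\<lambda>x. \<bar>f x\<bar> * C)"
      by (intro set_integrable_mult_left set_integrable_abs)
    then show ?thesis
    proof (rule regular_dist_shrinking_tendsto_0[OF _ d(1) _ e_lim \<phi>_bound \<phi>_supp])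
      fix x :: real assume "\<bar>x\<bar> \<le> d"
      from d(3)[OF this] show "\<bar>f x * g x\<bar> \<le> \<bar>f x\<bar> * C"
        by (simp add: abs_mult mult_left_mono)
    qed
  qed
  have one: "locally_integrable I (\<lambda>_. 1)"
    by (auto simp: locally_integrable_def set_integrable_def
        intro!: borel_compact emeasure_compact_finite)
  have "((\<lambda>\<tau>. (h \<tau>)\<^sup>2 * (b \<tau>)\<^sup>2) \<longlongrightarrow> H\<^sub>1\<^sup>2 * a\<^sub>S\<^sup>2) (at_right 0)"
    "((\<lambda>\<tau>. (h \<tau>)\<^sup>2 * (b \<tau>)\<^sup>2) \<longlongrightarrow> H\<^sub>2\<^sup>2 * a\<^sub>S\<^sup>2) (at_left 0)"
    by (intro tendsto_intros h_lim b_lim)+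
  from vanish[OF one this]
  have kin: "(\<lambda>k. regular_dist (\<lambda>\<tau>. (h \<tau>)\<^sup>2 * (b \<tau>)\<^sup>2) (\<phi> k)) \<longlonglongrightarrow> 0" by simp
  have "((\<lambda>\<tau>. \<rho>\<^sub>m\<^sub>0 / (b \<tau>) ^ 3 * (b \<tau>)\<^sup>2) \<longlongrightarrow> \<rho>\<^sub>m\<^sub>0 / a\<^sub>S ^ 3 * a\<^sub>S\<^sup>2) (at 0 within S)" for S
    by (intro tendsto_intros b_lim) (use \<open>a\<^sub>S > 0\<close> in simp)
  from vanish[OF one this this]
  have dust: "(\<lambda>k. regular_dist (\<lambda>\<tau>. \<rho>\<^sub>m\<^sub>0 / (b \<tau>) ^ 3 * (b \<tau>)\<^sup>2) (\<phi> k)) \<longlonglongrightarrow> 0" by simp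
  have "((\<lambda>\<tau>. (b \<tau>)\<^sup>2) \<longlongrightarrow> a\<^sub>S\<^sup>2) (at 0 within S)" for S
    by (intro tendsto_intros b_lim)
  from vanish[OF \<open>locally_integrable I p\<close> this this]
  have press: "(\<lambda>k. regular_dist (\<lambda>\<tau>. p \<tau> * (b \<tau>)\<^sup>2) (\<phi> k)) \<longlonglongrightarrow> 0" .
  obtain M where M: "M \<ge> 0" "\<And>x. \<bar>P x\<bar> \<le> M"
    using \<open>bounded (range P)\<close> by (auto simp: bounded_pos intro: less_imp_le)
  have gas: "(\<lambda>k. \<rho>ACh_a2 (\<phi> k)) \<longlonglongrightarrow> 0"
  proof (rule Lim_null_comparison)
    have "set_integrable lborel {-1..1} (\<lambda>\<tau>. R \<tau> powr (- \<omega>))"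
      using W by (simp add: locally_integrable_def)
    from set_integral_shrinking_tendsto_0[OF this zero_less_one tendsto_mult_right_zero[OF e_lim]]
    show "(\<lambda>k. M * K * (LINT x:{- (2 * e k)..2 * e k}|lborel. R x powr (- \<omega>))) \<longlonglongrightarrow> 0"
      by (rule tendsto_mult_right_zero)
    show "\<forall>\<^sub>F k in sequentially. norm (\<rho>ACh_a2 (\<phi> k)) \<le>
        M * K * (LINT x:{- (2 * e k)..2 * e k}|lborel. R x powr (- \<omega>))"
      using has_composition_bound[OF \<rho> \<open>\<omega> > 0\<close> M R Q W comp \<phi>_test _ \<phi>_bound \<phi>_supp e_pos] K(1)
      by simp
  qed

  have lhs: "(\<lambda>k. regular_dist (\<lambda>\<tau>. h \<tau> * (b \<tau>)\<^sup>2) (deriv (\<phi> k)))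
      \<longlonglongrightarrow> (H\<^sub>2 * a\<^sub>S\<^sup>2 - H\<^sub>1 * a\<^sub>S\<^sup>2) * \<psi> 0"
    unfolding \<phi>_def[abs_def]
    by (rule regular_dist_deriv_rescaled_tendsto[OF \<psi>(1,2) \<open>r > 0\<close> hb_cont _ _ e_lim e_pos])
       (assumption | intro tendsto_intros h_lim b_lim)+
  \<comment> \<open>The minus sign from time reversal and the one in the distributional derivative
    cancel, so the left side is tested against \<open>deriv (\<phi> k)\<close> directly. The delta
    term does not depend on \<open>k\<close>, since \<open>\<phi> k 0 = \<psi> 0\<close>.\<close>
  have eq: "regular_dist (\<lambda>\<tau>. h \<tau> * (b \<tau>)\<^sup>2) (deriv (\<phi> k)) =
      - regular_dist (\<lambda>\<tau>. (h \<tau>)\<^sup>2 * (b \<tau>)\<^sup>2) (\<phi> k) +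
      3/2 * (regular_dist (\<lambda>\<tau>. \<rho>\<^sub>m\<^sub>0 / (b \<tau>) ^ 3 * (b \<tau>)\<^sup>2) (\<phi> k) + \<rho>ACh_a2 (\<phi> k)
        - regular_dist (\<lambda>\<tau>. p \<tau> * (b \<tau>)\<^sup>2) (\<phi> k) - p\<^sub>\<delta> * (a\<^sub>S\<^sup>2 * \<psi> 0))" for k
    using equation \<phi>_test[of k] \<open>a t\<^sub>S = a\<^sub>S\<close>
    unfolding dist_eq_def dist_deriv_def times_delta_def h_def b_def
    by (simp add: \<phi>_def)
  have "(\<lambda>k. regular_dist (\<lambda>\<tau>. h \<tau> * (b \<tau>)\<^sup>2) (deriv (\<phi> k)))
      \<longlonglongrightarrow> - 0 + 3/2 * (0 + 0 - 0 - p\<^sub>\<delta> * (a\<^sub>S\<^sup>2 * \<psi> 0))"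
    unfolding eq by (intro tendsto_intros kin dust gas press)
  from LIMSEQ_unique[OF lhs this]
  have "(H\<^sub>2 - H\<^sub>1) * (a\<^sub>S\<^sup>2 * \<psi> 0) = - (3/2) * p\<^sub>\<delta> * (a\<^sub>S\<^sup>2 * \<psi> 0)"
    by (simp add: algebra_simps)
  moreover have "a\<^sub>S\<^sup>2 * \<psi> 0 \<noteq> 0" using \<open>a\<^sub>S > 0\<close> \<psi>(3) by simp
  ultimately have jump: "H\<^sub>2 - H\<^sub>1 = - (3/2) * p\<^sub>\<delta>"
    using mult_right_cancel by blast
  then have 1: "jump (hubble a) t\<^sub>S = - (3/2) * p\<^sub>\<delta>"
    using tendsto_Lim[OF _ H\<^sub>1] tendsto_Lim[OF _ H\<^sub>2] by (simp add: jump_def)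

  have "\<forall>\<^sub>F t in at t\<^sub>S. t \<in> ?U - {t\<^sub>S}"
    using eventually_at_in_open[of ?U t\<^sub>S] \<open>r > 0\<close> by simp
  then have "\<forall>\<^sub>F t in at t\<^sub>S. a differentiable at t \<and> a t \<noteq> 0"
    by eventually_elim (use a_diff a_pos in force)
  then have 2: "second_junction_condition (flat_metric a) t\<^sub>S (p\<^sub>\<delta> *\<^sub>R flat_metric a t\<^sub>S)"
    using \<open>a\<^sub>S > 0\<close> \<open>a t\<^sub>S = a\<^sub>S\<close> jump
    by (intro flat_metric_second_junction_condition[OF H\<^sub>1 H\<^sub>2 a_isCont]) auto
  have "first_junction_condition (flat_metric a) t\<^sub>S"
    unfolding first_junction_condition_def flat_metric_def by (intro continuous_intros a_isCont)
  with 1 2 show ?thesis by (simp add: joinable_def)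
qed

end
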